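(* Let $\mathcal{S}_2:=\{W\in\mathcal{Q}_2:\ W^*W=1,\ WU=U^2W,\ WW^*+UWW^*U^*=1\}$. If $s\in\mathcal{S}_2$, then there exists $f\in C(\mathbb{T},\mathbb{T})$ such that $s=f(U)S_2$.
   Context: The $2$-adic ring $C^*$-algebra $\mathcal{Q}_2$ is the universal (unital) $C^*$-algebra generated by a unitary $U$ and an isometry $S_2$ satisfying $S_2U=U^2S_2$ and $S_2S_2^*+US_2S_2^*U^*=1$. $\mathbb{T}$ is the set of complex numbers of modulus one, $C(\mathbb{T},\mathbb{T})$ is the set of continuous functions from $\mathbb{T}$ to $\mathbb{T}$, and $f(U)$ is defined by continuous functional calculus. *)

theory Defs
  imports "HOL-Analysis.Analysis" "HOL-Algebra.Ring"
begin

section \<open>Unital C*-algebras\<close>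

text \<open>
  Two renderings are needed. The algebra under study is a type of the class below. The
  algebras against which its universal property is tested have to be quantified over inside a
  formula, so they are structures with an explicit carrier.
  As in the library's class of unital rings, unital algebras are taken to be nonzero.
\<close>

class unital_cstar_algebra = real_normed_algebra_1 + banach +
  fixes scaleC :: "complex \<Rightarrow> 'a \<Rightarrow> 'a"  (infixr "*\<^sub>C" 75)
    and adj :: "'a \<Rightarrow> 'a"  ("_\<^sup>\<star>" [1000] 999)
  assumes scaleC_add_right: "c *\<^sub>C (x + y) = c *\<^sub>C x + c *\<^sub>C y"
    and scaleC_add_left: "(c + d) *\<^sub>C x = c *\<^sub>C x + d *\<^sub>C x"
    and scaleC_scaleC: "c *\<^sub>C d *\<^sub>C x = (c * d) *\<^sub>C x"
    and scaleR_scaleC: "r *\<^sub>R x = complex_of_real r *\<^sub>C x"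
    and mult_scaleC_left: "(c *\<^sub>C x) * y = c *\<^sub>C (x * y)"
    and mult_scaleC_right: "x * (c *\<^sub>C y) = c *\<^sub>C (x * y)"
    and norm_scaleC: "norm (c *\<^sub>C x) = cmod c * norm x"
    and adj_adj: "(x\<^sup>\<star>)\<^sup>\<star> = x"
    and adj_add: "(x + y)\<^sup>\<star> = x\<^sup>\<star> + y\<^sup>\<star>"
    and adj_mult: "(x * y)\<^sup>\<star> = y\<^sup>\<star> * x\<^sup>\<star>"
    and adj_scaleC: "(c *\<^sub>C x)\<^sup>\<star> = cnj c *\<^sub>C x\<^sup>\<star>"
    and cstar_identity: "norm (x\<^sup>\<star> * x) = (norm x)\<^sup>2"

record 'b cstar = "'b ring" +
  cscale :: "complex \<Rightarrow> 'b \<Rightarrow> 'b"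
  cadj :: "'b \<Rightarrow> 'b"
  cnorm :: "'b \<Rightarrow> real"

locale unital_cstar_structure = ring B for B :: "'b cstar" (structure) +
  assumes one_neq_zero: "\<one> \<noteq> \<zero>"
    and cscale_closed: "x \<in> carrier B \<Longrightarrow> cscale B c x \<in> carrier B"
    and cscale_add_right: "\<lbrakk>x \<in> carrier B; y \<in> carrier B\<rbrakk> \<Longrightarrow>
          cscale B c (x \<oplus> y) = cscale B c x \<oplus> cscale B c y"
    and cscale_add_left: "x \<in> carrier B \<Longrightarrow>
          cscale B (c + d) x = cscale B c x \<oplus> cscale B d x"
    and cscale_cscale: "x \<in> carrier B \<Longrightarrow> cscale B c (cscale B d x) = cscale B (c * d) x"
    and cscale_one: "x \<in> carrier B \<Longrightarrow> cscale B 1 x = x"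
    and mult_cscale_left: "\<lbrakk>x \<in> carrier B; y \<in> carrier B\<rbrakk> \<Longrightarrow>
          cscale B c x \<otimes> y = cscale B c (x \<otimes> y)"
    and mult_cscale_right: "\<lbrakk>x \<in> carrier B; y \<in> carrier B\<rbrakk> \<Longrightarrow>
          x \<otimes> cscale B c y = cscale B c (x \<otimes> y)"
    and cadj_closed: "x \<in> carrier B \<Longrightarrow> cadj B x \<in> carrier B"
    and cadj_cadj: "x \<in> carrier B \<Longrightarrow> cadj B (cadj B x) = x"
    and cadj_add: "\<lbrakk>x \<in> carrier B; y \<in> carrier B\<rbrakk> \<Longrightarrow>
          cadj B (x \<oplus> y) = cadj B x \<oplus> cadj B y"
    and cadj_mult: "\<lbrakk>x \<in> carrier B; y \<in> carrier B\<rbrakk> \<Longrightarrow>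
          cadj B (x \<otimes> y) = cadj B y \<otimes> cadj B x"
    and cadj_cscale: "x \<in> carrier B \<Longrightarrow> cadj B (cscale B c x) = cscale B (cnj c) (cadj B x)"
    and cnorm_eq_zero: "x \<in> carrier B \<Longrightarrow> cnorm B x = 0 \<longleftrightarrow> x = \<zero>"
    and cnorm_triangle: "\<lbrakk>x \<in> carrier B; y \<in> carrier B\<rbrakk> \<Longrightarrow>
          cnorm B (x \<oplus> y) \<le> cnorm B x + cnorm B y"
    and cnorm_cscale: "x \<in> carrier B \<Longrightarrow> cnorm B (cscale B c x) = cmod c * cnorm B x"
    and cnorm_mult: "\<lbrakk>x \<in> carrier B; y \<in> carrier B\<rbrakk> \<Longrightarrow>
          cnorm B (x \<otimes> y) \<le> cnorm B x * cnorm B y"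
    and cnorm_cstar: "x \<in> carrier B \<Longrightarrow> cnorm B (cadj B x \<otimes> x) = (cnorm B x)\<^sup>2"
    and cnorm_complete:
      "\<lbrakk>\<And>n. X n \<in> carrier B;
        \<And>e. e > 0 \<Longrightarrow> \<exists>N. \<forall>m\<ge>N. \<forall>n\<ge>N. cnorm B (X m \<ominus> X n) < e\<rbrakk> \<Longrightarrow>
          \<exists>x\<in>carrier B. (\<lambda>n. cnorm B (X n \<ominus> x)) \<longlonglongrightarrow> 0"

definition cstar_of_type :: "'a::unital_cstar_algebra cstar" where
  "cstar_of_type =
     \<lparr>carrier = UNIV, mult = (*), one = 1, zero = 0, add = (+),
      cscale = scaleC, cadj = adj, cnorm = norm\<rparr>"

text \<open>The two renderings agree.\<close>

lemma unital_cstar_structure_of_type: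
  "unital_cstar_structure (cstar_of_type :: 'a::unital_cstar_algebra cstar)"
proof -
  let ?B = "cstar_of_type :: 'a cstar"
  have sel: "carrier ?B = UNIV" "mult ?B = (*)" "one ?B = 1" "zero ?B = 0" "add ?B = (+)"
    "cscale ?B = scaleC" "cadj ?B = adj" "cnorm ?B = norm"
    by (simp_all add: cstar_of_type_def)
  have "abelian_group ?B"
    by (rule abelian_groupI) (auto simp: sel ac_simps intro: exI[of _ "- x" for x] left_minus)
  moreover have "Group.monoid ?B"
    by (rule monoidI) (auto simp: sel mult.assoc)
  ultimately interpret R: ring ?B
    by (rule ringI) (auto simp: sel algebra_simps)
  have "x \<oplus>\<^bsub>?B\<^esub> (- x) = \<zero>\<^bsub>?B\<^esub>" for x by (simp add: sel)
  hence neg: "\<ominus>\<^bsub>?B\<^esub> x = - x" for x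
    by (metis R.minus_equality R.a_comm UNIV_I sel(1))
  have diff: "x \<ominus>\<^bsub>?B\<^esub> y = x - y" for x y
    by (simp add: a_minus_def neg sel)
  have complete: "\<exists>x\<in>carrier ?B. (\<lambda>n. cnorm ?B (X n \<ominus>\<^bsub>?B\<^esub> x)) \<longlonglongrightarrow> 0"
    if "\<And>e. e > 0 \<Longrightarrow> \<exists>N. \<forall>m\<ge>N. \<forall>n\<ge>N. cnorm ?B (X m \<ominus>\<^bsub>?B\<^esub> X n) < e" for X
  proof -
    have "Cauchy X"
      using that by (auto simp: Cauchy_def dist_norm diff sel)
    then obtain x where "X \<longlonglongrightarrow> x"
      using Cauchy_convergent convergent_def by blast
    hence "(\<lambda>n. norm (X n - x)) \<longlonglongrightarrow> 0"
      by (simp add: LIM_zero_iff tendsto_norm_zero_iff)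
    thus ?thesis by (auto simp: sel diff)
  qed
  show ?thesis
    by (unfold_locales; (rule complete; assumption)?)
      (auto simp: sel scaleC_add_right scaleC_add_left scaleC_scaleC mult_scaleC_left
        mult_scaleC_right adj_adj adj_add adj_mult adj_scaleC norm_triangle_ineq norm_scaleC
        norm_mult_ineq cstar_identity scaleR_scaleC[of 1, simplified, symmetric])
qed

definition unital_star_hom :: "('a::unital_cstar_algebra \<Rightarrow> 'b) \<Rightarrow> 'b cstar \<Rightarrow> bool" where
  "unital_star_hom \<phi> B \<longleftrightarrow>
     (\<forall>x. \<phi> x \<in> carrier B) \<and>
     (\<forall>x y. \<phi> (x + y) = \<phi> x \<oplus>\<^bsub>B\<^esub> \<phi> y) \<and>
     (\<forall>x y. \<phi> (x * y) = \<phi> x \<otimes>\<^bsub>B\<^esub> \<phi> y) \<and>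
     (\<forall>c x. \<phi> (c *\<^sub>C x) = cscale B c (\<phi> x)) \<and>
     (\<forall>x. \<phi> (x\<^sup>\<star>) = cadj B (\<phi> x)) \<and>
     \<phi> 1 = \<one>\<^bsub>B\<^esub>"

definition unital_cstar_subalgebra :: "'a::unital_cstar_algebra set \<Rightarrow> bool" where
  "unital_cstar_subalgebra C \<longleftrightarrow>
     1 \<in> C \<and> (\<forall>x\<in>C. \<forall>y\<in>C. x + y \<in> C \<and> x * y \<in> C) \<and>
     (\<forall>c. \<forall>x\<in>C. c *\<^sub>C x \<in> C) \<and> (\<forall>x\<in>C. x\<^sup>\<star> \<in> C) \<and> closed C"

section \<open>Continuous functional calculus\<close>

definition spectrum :: "'a::unital_cstar_algebra \<Rightarrow> complex set" where
  "spectrum a = {z. \<not> (\<exists>b. b * (a - z *\<^sub>C 1) = 1 \<and> (a - z *\<^sub>C 1) * b = 1)}"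

text \<open>
  \<open>\<Phi>\<close> is a unital *-homomorphism from \<open>C(spectrum a)\<close> that sends the identity function to \<open>a\<close>.
  Elements of \<open>C(spectrum a)\<close> are represented by functions on the whole plane that are
  continuous on the spectrum; the last clause says that only their values there matter.
\<close>

definition is_functional_calculus ::
    "'a::unital_cstar_algebra \<Rightarrow> ((complex \<Rightarrow> complex) \<Rightarrow> 'a) \<Rightarrow> bool" where
  "is_functional_calculus a \<Phi> \<longleftrightarrow>
     (let C = {f. continuous_on (spectrum a) f} in
      (\<forall>f\<in>C. \<forall>g\<in>C. \<Phi> (\<lambda>z. f z + g z) = \<Phi> f + \<Phi> g) \<and>
      (\<forall>f\<in>C. \<forall>g\<in>C. \<Phi> (\<lambda>z. f z * g z) = \<Phi> f * \<Phi> g) \<and>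
      (\<forall>c. \<forall>f\<in>C. \<Phi> (\<lambda>z. c * f z) = c *\<^sub>C \<Phi> f) \<and>
      (\<forall>f\<in>C. \<Phi> (\<lambda>z. cnj (f z)) = (\<Phi> f)\<^sup>\<star>) \<and>
      \<Phi> (\<lambda>z. 1) = 1 \<and> \<Phi> (\<lambda>z. z) = a \<and>
      (\<forall>f\<in>C. \<forall>g\<in>C. (\<forall>z\<in>spectrum a. f z = g z) \<longrightarrow> \<Phi> f = \<Phi> g))"

text \<open>
  For normal \<open>a\<close> and \<open>f\<close> continuous on the spectrum of \<open>a\<close>, this is \<open>f(a)\<close>: such a \<open>\<Phi>\<close> exists
  and its value at \<open>f\<close> is unique. In all other cases the value is meaningless.
\<close>

definition cfc :: "(complex \<Rightarrow> complex) \<Rightarrow> 'a::unital_cstar_algebra \<Rightarrow> 'a" where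
  "cfc f a = (THE b. \<exists>\<Phi>. is_functional_calculus a \<Phi> \<and> \<Phi> f = b)"

section \<open>The 2-adic ring C*-algebra\<close>

definition unitary :: "'a::unital_cstar_algebra \<Rightarrow> bool" where
  "unitary u \<longleftrightarrow> u\<^sup>\<star> * u = 1 \<and> u * u\<^sup>\<star> = 1"

definition S2_set :: "'a::unital_cstar_algebra \<Rightarrow> 'a set" where
  "S2_set U = {W. W\<^sup>\<star> * W = 1 \<and> W * U = U\<^sup>2 * W \<and> W * W\<^sup>\<star> + U * W * W\<^sup>\<star> * U\<^sup>\<star> = 1}"

definition Q2_relations :: "'b cstar \<Rightarrow> 'b \<Rightarrow> 'b \<Rightarrow> bool" where
  "Q2_relations B u v \<longleftrightarrow>
     u \<in> carrier B \<and> v \<in> carrier B \<and>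
     cadj B u \<otimes>\<^bsub>B\<^esub> u = \<one>\<^bsub>B\<^esub> \<and> u \<otimes>\<^bsub>B\<^esub> cadj B u = \<one>\<^bsub>B\<^esub> \<and>
     cadj B v \<otimes>\<^bsub>B\<^esub> v = \<one>\<^bsub>B\<^esub> \<and>
     v \<otimes>\<^bsub>B\<^esub> u = u \<otimes>\<^bsub>B\<^esub> u \<otimes>\<^bsub>B\<^esub> v \<and>
     v \<otimes>\<^bsub>B\<^esub> cadj B v \<oplus>\<^bsub>B\<^esub> u \<otimes>\<^bsub>B\<^esub> v \<otimes>\<^bsub>B\<^esub> cadj B v \<otimes>\<^bsub>B\<^esub> cadj B u = \<one>\<^bsub>B\<^esub>"

text \<open>
  The type \<open>'a\<close>, with generators \<open>U\<close> and \<open>S\<close>, is the universal C*-algebra for the relations.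
  The test algebras \<open>B\<close> live on arbitrary subsets of \<open>'a\<close>, with operations unrelated to those
  of \<open>'a\<close>. Nothing is lost by this: a nonzero C*-algebra generated by two elements is separable
  and so has exactly the cardinality of the continuum. Hence so has \<open>'a\<close>, and for every pair
  satisfying the relations, in a C*-algebra of any size, the C*-subalgebra which the pair
  generates has an isomorphic copy on a subset of \<open>'a\<close>.
  Uniqueness of \<open>\<phi>\<close> is automatic, since \<open>U\<close> and \<open>S\<close> generate.
\<close>

definition is_Q2 :: "'a::unital_cstar_algebra \<Rightarrow> 'a \<Rightarrow> bool" where
  "is_Q2 U S \<longleftrightarrow>
     unitary U \<and> S\<^sup>\<star> * S = 1 \<and> S * U = U\<^sup>2 * S \<and> S * S\<^sup>\<star> + U * S * S\<^sup>\<star> * U\<^sup>\<star> = 1 \<and>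
     unital_cstar_subalgebra hull {U, S} = UNIV \<and>
     (\<forall>(B :: 'a cstar) u v. unital_cstar_structure B \<and> Q2_relations B u v \<longrightarrow>
        (\<exists>\<phi>. unital_star_hom \<phi> B \<and> \<phi> U = u \<and> \<phi> S = v))"

end

theory Submission
  imports Defs
begin

text \<open>
  Put \<open>V = s * S\<^sup>\<star> + U * s * S\<^sup>\<star> * U\<^sup>\<star>\<close> with \<open>S\<close> the given isometry. The relations give \<open>V * S = s\<close>,
  \<open>V\<^sup>\<star> * V = 1\<close> and \<open>V * U = U * V\<close>. If \<open>V = f(U)\<close> with \<open>f\<close> continuous on the spectrum of \<open>U\<close>, which is
  the whole circle, then \<open>V\<^sup>\<star> * V = 1\<close> says \<open>\<bar>f\<bar> = 1\<close>, and the theorem follows. So the point is that the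
  C*-algebra generated by \<open>U\<close> is its own commutant (\<open>commutant_U\<close>).

  Multiplying \<open>S\<close> by scalars of modulus one preserves the relations, so by universality the circle
  acts on the algebra, fixing \<open>U\<close>. Monomials \<open>U ^ a * S ^ i * S\<^sup>\<star> ^ j * U ^ b\<close> have degree
  \<open>i - j\<close> for this action and span a dense subspace. On elements of degree zero, the averages over
  conjugation by \<open>U ^ k\<close>, \<open>k < 2 ^ m\<close>, converge in norm to elements of the algebra generated by
  \<open>U\<close>: the conjugates of \<open>S ^ i * S\<^sup>\<star> ^ i\<close> sum to one. An element of degree zero which commutes with
  \<open>U\<close> equals its averages, hence lies in that algebra. For an element \<open>y\<close> of degree \<open>n \<noteq> 0\<close> which
  commutes with \<open>U\<close>, the averages of the degree-zero elements among the \<open>y * S ^ i * S\<^sup>\<star> ^ j\<close> converge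
  to functions \<open>g\<close> of \<open>U\<close> with \<open>z ^ 2 ^ i * g(z) = g(z) * z ^ 2 ^ j\<close> and \<open>i \<noteq> j\<close>, so \<open>g = 0\<close> and,
  by density, the averages of \<open>y * y\<^sup>\<star>\<close>, all equal to \<open>y * y\<^sup>\<star>\<close>, converge to zero
  (\<open>commuting_of_nonzero_degree\<close>). Thus an element commuting with \<open>U\<close> has no Fourier components of
  nonzero degree, and being the limit of its Cesaro means it has degree zero.

  Two analytic facts support this. The gauge action is contractive because a self-adjoint element of
  norm below one is the real part of a unitary (\<open>star_hom_contractive\<close>). And Laurent polynomials
  satisfy \<open>norm (p(U)) = sup \<bar>p\<bar>\<close> (\<open>norm_laurent_le\<close>, \<open>full_unitary_U\<close>): each coefficient is at most
  \<open>sup \<bar>p\<bar>\<close>, and also at most \<open>norm (p(U))\<close>, since compressing by \<open>S ^ n\<close> extracts the constant term. This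
  gives both inequalities up to a factor linear in the degree, which disappears on passing to powers.
  The functional calculus is the closure of evaluation of Laurent polynomials.
\<close>

section \<open>C*-algebra preliminaries\<close>

lemma scaleC_one [simp]: "1 *\<^sub>C x = (x :: 'a::unital_cstar_algebra)"
  by (metis of_real_1 scaleR_one scaleR_scaleC)

lemma bounded_bilinear_scaleC:
  "bounded_bilinear (scaleC :: complex \<Rightarrow> 'a::unital_cstar_algebra \<Rightarrow> 'a)"
proof
  show "(r *\<^sub>R c) *\<^sub>C x = r *\<^sub>R (c *\<^sub>C x)" for r c and x :: 'a
    by (simp add: scaleR_scaleC scaleC_scaleC scaleR_conv_of_real)
  show "c *\<^sub>C (r *\<^sub>R x) = r *\<^sub>R (c *\<^sub>C x)" for r c and x :: 'a
    by (simp add: scaleR_scaleC scaleC_scaleC mult.commute)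
  show "\<exists>K. \<forall>c (x :: 'a). norm (c *\<^sub>C x) \<le> norm c * norm x * K"
    by (intro exI[of _ 1]) (simp add: norm_scaleC)
qed (simp_all add: scaleC_add_left scaleC_add_right)

interpretation scaleC: bounded_bilinear scaleC
  by (rule bounded_bilinear_scaleC)

lemma scaleC_mult_scaleC:
  "(c *\<^sub>C x) * (d *\<^sub>C y) = (c * d) *\<^sub>C (x * y :: 'a::unital_cstar_algebra)"
  by (simp add: mult_scaleC_left mult_scaleC_right scaleC_scaleC mult.commute)

lemma norm_adj [simp]: "norm (x\<^sup>\<star>) = norm (x :: 'a::unital_cstar_algebra)"
proof -
  have le: "norm y \<le> norm (y\<^sup>\<star>)" for y :: 'a
  proof (cases "y = 0")
    case False
    have "norm y * norm y \<le> norm (y\<^sup>\<star>) * norm y"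
      using norm_mult_ineq[of "y\<^sup>\<star>" y] by (simp add: cstar_identity power2_eq_square)
    thus ?thesis using False by simp
  qed simp
  show ?thesis using le[of x] le[of "x\<^sup>\<star>"] by (simp add: adj_adj)
qed

lemma adj_scaleR: "(r *\<^sub>R x)\<^sup>\<star> = r *\<^sub>R (x\<^sup>\<star> :: 'a::unital_cstar_algebra)"
  by (simp add: scaleR_scaleC adj_scaleC)

lemma bounded_linear_adj: "bounded_linear (adj :: 'a::unital_cstar_algebra \<Rightarrow> 'a)"
  by (rule bounded_linear_intro[where K = 1]) (simp_all add: adj_add adj_scaleR)

lemmas adj_zero [simp] = linear_0[OF bounded_linear.linear[OF bounded_linear_adj]]
  and adj_diff = linear_diff[OF bounded_linear.linear[OF bounded_linear_adj]]
  and adj_sum = linear_sum[OF bounded_linear.linear[OF bounded_linear_adj]]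
  and continuous_on_adj = bounded_linear.continuous_on[OF bounded_linear_adj]

lemma adj_one [simp]: "(1 :: 'a::unital_cstar_algebra)\<^sup>\<star> = 1"
  by (metis adj_adj adj_mult mult_1_left mult_1_right)

lemma adj_power: "(x ^ n)\<^sup>\<star> = (x\<^sup>\<star> :: 'a::unital_cstar_algebra) ^ n"
  by (induction n) (simp_all add: adj_mult power_commutes)

lemma norm_isometry: "v\<^sup>\<star> * v = 1 \<Longrightarrow> norm (v :: 'a::unital_cstar_algebra) = 1"
  using cstar_identity[of v] by (simp add: power2_eq_1_iff) (metis norm_ge_zero not_one_le_zero neg_0_le_iff_le)

lemma eq_zero_of_mult_adj: "x * x\<^sup>\<star> = 0 \<Longrightarrow> x = (0 :: 'a::unital_cstar_algebra)"
  using cstar_identity[of "x\<^sup>\<star>"] by (simp add: adj_adj)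

text \<open>
  Squaring a self-adjoint element squares its norm. Together with an estimate for the norm of
  powers that grows only linearly in the exponent, this turns crude norm bounds into sharp ones.
\<close>

lemma norm_self_adjoint_power:
  fixes h :: "'a::unital_cstar_algebra"
  assumes "h\<^sup>\<star> = h"
  shows "norm (h ^ (2 ^ k)) = norm h ^ (2 ^ k)"
proof (induction k)
  case (Suc k)
  have "norm (h ^ (2 ^ Suc k)) = norm ((h ^ (2 ^ k))\<^sup>\<star> * h ^ (2 ^ k))"
    by (simp add: adj_power assms mult_2 flip: power_add)
  also have "\<dots> = norm h ^ (2 ^ Suc k)"
    by (simp add: cstar_identity Suc power2_eq_square mult_2 flip: power_add)
  finally show ?case .
qed simp

text \<open>
  The square root of \<open>1 - a\<^sup>2\<close>: the equation \<open>(1 - c)\<^sup>2 = 1 - a\<^sup>2\<close> is the fixed point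
  equation \<open>c = (a\<^sup>2 + c\<^sup>2) / 2\<close>, and its right-hand side is a contraction of the ball of
  radius \<open>norm a\<close>.
\<close>

lemma exists_sqrt_one_minus_square:
  fixes a :: "'a::unital_cstar_algebra"
  assumes a: "a\<^sup>\<star> = a" "norm a < 1"
  obtains b where "b\<^sup>\<star> = b" "a * b = b * a" "b * b = 1 - a * a"
proof -
  define B where "B = {c. norm c \<le> norm a \<and> c\<^sup>\<star> = c \<and> a * c = c * a}"
  define F where "F c = (1 / 2) *\<^sub>R (a * a + c * c)" for c
  have "closed B"
    unfolding B_def by (intro closed_Collect_conj closed_Collect_le closed_Collect_eq
        continuous_intros continuous_on_adj)
  moreover have "B \<noteq> {}" using a by (auto simp: B_def)
  moreover have "F ` B \<subseteq> B"
  proof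
    fix y assume "y \<in> F ` B"
    then obtain c where c: "norm c \<le> norm a" "c\<^sup>\<star> = c" "a * c = c * a" and y: "y = F c"
      by (auto simp: B_def)
    have sq: "norm a * norm a \<le> norm a"
      using a by (simp add: mult_left_le)
    have "norm (c * c) \<le> norm a * norm a"
      by (rule order_trans[OF norm_mult_ineq]) (intro mult_mono c norm_ge_zero)
    moreover have "norm (a * a) \<le> norm a * norm a" by (rule norm_mult_ineq)
    ultimately have "norm (a * a + c * c) \<le> 2 * norm a"
      using norm_triangle_ineq[of "a * a" "c * c"] sq by linarith
    hence "norm (F c) \<le> norm a" by (simp add: F_def flip: scaleR_add_right)
    moreover have "a * (c * c) = c * c * a"
      by (metis c(3) mult.assoc)
    ultimately show "y \<in> B"
      using c a by (auto simp: B_def y) (auto simp: F_def adj_scaleR adj_add adj_mult algebra_simps)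
  qed
  moreover have "dist (F c) (F d) \<le> norm a * dist c d" if "c \<in> B" "d \<in> B" for c d
  proof -
    have "F c - F d = (1 / 2) *\<^sub>R (c * (c - d) + (c - d) * d)"
      by (simp add: F_def algebra_simps)
    also have "norm \<dots> \<le> (1 / 2) * (norm c * norm (c - d) + norm (c - d) * norm d)"
      using norm_triangle_mono[OF norm_mult_ineq norm_mult_ineq, of c "c - d" "c - d" d] by simp
    also have "\<dots> \<le> (1 / 2) * (norm a * norm (c - d) + norm (c - d) * norm a)"
      using that by (intro mult_left_mono add_mono mult_mono) (auto simp: B_def)
    finally show ?thesis by (simp add: dist_norm)
  qed
  ultimately obtain c where "c \<in> B" "F c = c"
    using Banach_fix[of B "norm a" F] a(2) by (auto simp: complete_eq_closed)
  hence c: "c\<^sup>\<star> = c" "a * c = c * a" and Fc: "a * a + c * c = 2 *\<^sub>R c"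
    by (auto simp: B_def F_def) (metis divide_self_if scaleR_half_double scaleR_one scaleR_scaleR
        times_divide_eq_right mult.right_neutral zero_neq_numeral)
  show thesis
  proof (rule that)
    show "(1 - c)\<^sup>\<star> = 1 - c" using c by (simp add: adj_diff)
    show "a * (1 - c) = (1 - c) * a" using c by (simp add: algebra_simps)
    have "c * c = c + c - a * a" using Fc by (simp add: scaleR_2 algebra_simps)
    thus "(1 - c) * (1 - c) = 1 - a * a" by (simp add: algebra_simps)
  qed
qed

text \<open>
  A self-adjoint \<open>a\<close> of norm less than one is the real part of the unitary
  \<open>a + \<i> sqrt (1 - a\<^sup>2)\<close>, and unital *-homomorphisms preserve unitaries.
\<close>

lemma star_hom_contractive:
  fixes \<phi> :: "'a::unital_cstar_algebra \<Rightarrow> 'b::unital_cstar_algebra"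
  assumes add: "\<And>x y. \<phi> (x + y) = \<phi> x + \<phi> y"
    and mult: "\<And>x y. \<phi> (x * y) = \<phi> x * \<phi> y"
    and scale: "\<And>c x. \<phi> (c *\<^sub>C x) = c *\<^sub>C \<phi> x"
    and adj: "\<And>x. \<phi> (x\<^sup>\<star>) = (\<phi> x)\<^sup>\<star>"
    and one: "\<phi> 1 = 1"
  shows "norm (\<phi> x) \<le> norm x"
proof -
  have unit_ball: "norm (\<phi> a) \<le> 1" if a: "a\<^sup>\<star> = a" "norm a < 1" for a
  proof -
    obtain b where b: "b\<^sup>\<star> = b" "a * b = b * a" "b * b = 1 - a * a"
      using exists_sqrt_one_minus_square[OF a] by blast
    define u where "u = a + \<i> *\<^sub>C b"
    have u_adj: "u\<^sup>\<star> = a - \<i> *\<^sub>C b"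
      by (simp add: u_def adj_add adj_scaleC a b scaleC.minus_left)
    have "u\<^sup>\<star> * u = 1"
      unfolding u_adj unfolding u_def
      by (simp add: algebra_simps mult_scaleC_left mult_scaleC_right scaleC_scaleC b
          scaleC.minus_left scaleC.diff_right scaleC_add_right)
    hence "(\<phi> u)\<^sup>\<star> * \<phi> u = 1" by (metis adj mult one)
    hence nu: "norm (\<phi> u) = 1" by (rule norm_isometry)
    have "u + u\<^sup>\<star> = 2 *\<^sub>R a"
      unfolding u_adj unfolding u_def by (simp add: scaleR_2)
    hence "2 *\<^sub>R \<phi> a = \<phi> u + (\<phi> u)\<^sup>\<star>"
      by (metis add adj scale scaleR_scaleC)
    hence "2 * norm (\<phi> a) \<le> 2"
      using norm_triangle_ineq[of "\<phi> u" "(\<phi> u)\<^sup>\<star>"] nu by (metis abs_numeral norm_adj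
          norm_scaleR one_add_one)
    thus ?thesis by simp
  qed
  have self_adjoint: "norm (\<phi> a) \<le> norm a" if a: "a\<^sup>\<star> = a" for a
  proof (rule field_le_epsilon)
    fix e :: real assume "e > 0"
    define r where "r = norm a + e"
    have r: "r > 0" "norm a < r" using \<open>e > 0\<close> by (auto simp: r_def add_nonneg_pos)
    have "norm (\<phi> ((1 / r) *\<^sub>R a)) \<le> 1"
      using r by (intro unit_ball) (auto simp: adj_scaleR a)
    hence "norm (\<phi> a) \<le> r"
      using r by (simp add: scaleR_scaleC scale norm_scaleC norm_divide divide_simps)
    thus "norm (\<phi> a) \<le> norm a + e" by (simp add: r_def)
  qed
  have "(norm (\<phi> x))\<^sup>2 \<le> (norm x)\<^sup>2"
    using self_adjoint[of "x\<^sup>\<star> * x"] by (simp add: adj_mult adj_adj mult adj cstar_identity)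
  thus ?thesis by simp
qed

section \<open>Laurent polynomials in a unitary\<close>

text \<open>
  The sharp norm estimates for Laurent polynomials come from estimates for \<open>n\<close>-th powers that lose a factor linear
  in \<open>n\<close>: a ratio larger than one would grow exponentially. Powers of two suffice, and they are the
  exponents for which norms of powers of self-adjoint elements are known.
\<close>

lemma le_of_power_le_linear:
  fixes a b D :: real
  assumes nonneg: "a \<ge> 0" "b \<ge> 0"
    and le: "\<And>k. a ^ (2 ^ k) \<le> (D * 2 ^ k + 1) * b ^ (2 ^ k)"
  shows "a \<le> b"
proof (rule ccontr)
  assume "\<not> a \<le> b"
  hence ab: "b < a" and a: "a > 0" using nonneg by auto
  define r where "r = b / a"
  have r: "0 \<le> r" "r < 1" using ab a nonneg by (auto simp: r_def)
  have "(\<lambda>n. D * (real n * r ^ n) + r ^ n) \<longlonglongrightarrow> D * 0 + 0"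
    using r by (intro tendsto_intros powser_times_n_limit_0 LIMSEQ_realpow_zero) auto
  moreover have "filterlim (\<lambda>k::nat. 2 ^ k :: nat) at_top sequentially"
    by (rule filterlim_subseq) (simp add: strict_mono_def)
  ultimately have "(\<lambda>k. D * (real (2 ^ k) * r ^ (2 ^ k)) + r ^ (2 ^ k)) \<longlonglongrightarrow> 0"
    by (auto dest: filterlim_compose)
  moreover have "1 \<le> D * (real (2 ^ k) * r ^ (2 ^ k)) + r ^ (2 ^ k)" for k
  proof -
    have "1 \<le> (D * 2 ^ k + 1) * b ^ (2 ^ k) / a ^ (2 ^ k)"
      using le[of k] a by (simp add: divide_simps)
    thus ?thesis by (simp add: r_def power_divide ring_distribs add_divide_distrib mult.assoc)
  qed
  ultimately have "1 \<le> (0 :: real)"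
    by (intro tendsto_lowerbound[of _ 0 sequentially]) auto
  thus False by simp
qed

definition circ :: "real \<Rightarrow> complex" where
  "circ t = cis (2 * pi * t)"

lemma norm_circ [simp]: "norm (circ t) = 1"
  by (simp add: circ_def)

lemma circ_powi: "circ t powi k = cis (2 * pi * of_int k * t)"
  by (simp add: circ_def cis_power_int mult_ac)

lemma continuous_on_circ_powi: "continuous_on A (\<lambda>t. circ t powi k)"
  unfolding circ_powi by (intro continuous_intros)

lemma has_integral_circ_powi:
  "((\<lambda>t. circ t powi k) has_integral (if k = 0 then 1 else 0)) {0..1}"
proof (cases "k = 0")
  case True
  thus ?thesis using has_integral_const_real[of "1::complex" 0 1] by simp
next
  case False
  define a where "a = 2 * pi * real_of_int k"
  have a: "a \<noteq> 0" using False by (simp add: a_def)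
  have "((\<lambda>t. circ t powi k) has_integral
      (1 / (\<i> * a)) * cis (a * 1) - (1 / (\<i> * a)) * cis (a * 0)) {0..1}"
  proof (rule fundamental_theorem_of_calculus)
    fix t :: real assume "t \<in> {0..1}"
    show "((\<lambda>t. (1 / (\<i> * a)) * cis (a * t)) has_vector_derivative circ t powi k)
        (at t within {0..1})"
    proof -
      have "((\<lambda>z. (1 / (\<i> * a)) * exp (\<i> * (of_real a * z))) has_field_derivative
          exp (\<i> * (of_real a * of_real t))) (at (of_real t))"
        using a by (auto intro!: derivative_eq_intros simp: field_simps)
      from has_vector_derivative_real_field[OF this] show ?thesis
        by (simp add: circ_powi a_def cis_conv_exp)
    qed
  qed simp
  moreover have "cis (a * 1) = 1"
    using cis_multiple_2pi[of "real_of_int k"] by (simp add: a_def)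
  ultimately show ?thesis using False by simp
qed

definition zpow :: "'a::unital_cstar_algebra \<Rightarrow> int \<Rightarrow> 'a" where
  "zpow u k = (if 0 \<le> k then u ^ nat k else (u\<^sup>\<star>) ^ nat (- k))"

lemma zpow_0 [simp]: "zpow u 0 = 1"
  and zpow_1 [simp]: "zpow u 1 = u"
  and zpow_minus_1: "zpow u (- 1) = u\<^sup>\<star>"
  by (simp_all add: zpow_def)

lemma adj_zpow: "(zpow u k)\<^sup>\<star> = zpow u (- k)"
  by (auto simp: zpow_def adj_power adj_adj)

text \<open>
  A relation between functions on the circle and their values at \<open>u\<close>, so that sums, products and
  adjoints can be formed without tracking coefficients. The degree \<open>d\<close> is recorded because the norm
  estimates for powers depend on it.
\<close>

definition laurent ::
    "'a::unital_cstar_algebra \<Rightarrow> nat \<Rightarrow> (complex \<Rightarrow> complex) \<Rightarrow> 'a \<Rightarrow> bool" where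
  "laurent u d f x \<longleftrightarrow> (\<exists>c.
     (\<forall>z\<in>sphere 0 1. f z = (\<Sum>k=-int d..int d. c k * z powi k)) \<and>
     x = (\<Sum>k=-int d..int d. c k *\<^sub>C zpow u k))"

lemma laurent_cong:
  "laurent u d f x \<Longrightarrow> (\<And>z. z \<in> sphere 0 1 \<Longrightarrow> f z = g z) \<Longrightarrow> laurent u d g x"
  by (auto simp: laurent_def)

lemma laurent_add:
  assumes "laurent u d f x" "laurent u d g y"
  shows "laurent u d (\<lambda>z. f z + g z) (x + y)"
proof -
  from assms obtain c c' where
    "\<forall>z\<in>sphere 0 1. f z = (\<Sum>k=-int d..int d. c k * z powi k)"
    "x = (\<Sum>k=-int d..int d. c k *\<^sub>C zpow u k)"
    "\<forall>z\<in>sphere 0 1. g z = (\<Sum>k=-int d..int d. c' k * z powi k)"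
    "y = (\<Sum>k=-int d..int d. c' k *\<^sub>C zpow u k)"
    unfolding laurent_def by blast
  thus ?thesis
    unfolding laurent_def
    by (intro exI[of _ "\<lambda>k. c k + c' k"]) (simp add: sum.distrib ring_distribs scaleC_add_left)
qed

lemma laurent_monomial:
  assumes "\<bar>k\<bar> \<le> int d"
  shows "laurent u d (\<lambda>z. c * z powi k) (c *\<^sub>C zpow u k)"
proof -
  have k: "k \<in> {-int d..int d}" using assms by auto
  have "(\<Sum>j=-int d..int d. (if j = k then c else 0) * z powi j) = c * z powi k" for z
    using k by (simp add: if_distrib[of "\<lambda>c. c * _"] cong: if_cong)
  moreover have "(\<Sum>j=-int d..int d. (if j = k then c else 0) *\<^sub>C zpow u j) = c *\<^sub>C zpow u k"
    using k by (simp add: if_distrib[of "\<lambda>c. c *\<^sub>C _"] scaleC.zero_left cong: if_cong)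
  ultimately show ?thesis
    unfolding laurent_def by (intro exI[of _ "\<lambda>j. if j = k then c else 0"]) simp
qed

lemma laurent_zero: "laurent u d (\<lambda>z. 0) 0"
  using laurent_monomial[of 0 d u 0] by (simp add: scaleC.zero_left)

lemma laurent_one: "laurent u d (\<lambda>z. 1) 1"
  using laurent_monomial[of 0 d u 1] by simp

lemma laurent_sum:
  assumes "\<And>i. i \<in> I \<Longrightarrow> laurent u d (f i) (x i)"
  shows "laurent u d (\<lambda>z. \<Sum>i\<in>I. f i z) (\<Sum>i\<in>I. x i)"
  using assms
proof (induction I rule: infinite_finite_induct)
  case (insert i I)
  thus ?case using laurent_add[of u d "f i" "x i"] by simp
qed (simp_all add: laurent_zero)

lemma laurent_mono:
  assumes "laurent u d f x" "d \<le> e"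
  shows "laurent u e f x"
proof -
  from assms obtain c where
    f: "\<And>z. z \<in> sphere 0 1 \<Longrightarrow> f z = (\<Sum>k=-int d..int d. c k * z powi k)" and
    x: "x = (\<Sum>k=-int d..int d. c k *\<^sub>C zpow u k)"
    unfolding laurent_def by blast
  have "laurent u e (\<lambda>z. \<Sum>k=-int d..int d. c k * z powi k) x"
    unfolding x using assms(2) by (intro laurent_sum laurent_monomial) auto
  thus ?thesis by (rule laurent_cong) (simp add: f)
qed

lemma laurent_add_any:
  assumes "laurent u d f x" "laurent u e g y"
  shows "laurent u (d + e) (\<lambda>z. f z + g z) (x + y)"
  by (intro laurent_add laurent_mono[OF assms(1)] laurent_mono[OF assms(2)]) auto

text \<open>Integrating against the character \<open>z powi (- j)\<close> isolates the \<open>j\<close>-th coefficient.\<close>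

lemma norm_laurent_coeff_le:
  fixes c :: "int \<Rightarrow> complex"
  assumes f: "\<And>z. z \<in> sphere 0 1 \<Longrightarrow> f z = (\<Sum>k=-int d..int d. c k * z powi k)"
    and B: "\<And>z. z \<in> sphere 0 1 \<Longrightarrow> norm (f z) \<le> B" and j: "j \<in> {-int d..int d}"
  shows "norm (c j) \<le> B"
proof -
  let ?I = "{-int d..int d}"
  have nz: "circ t \<noteq> 0" for t using norm_circ[of t] by force
  have "((\<lambda>t. \<Sum>k\<in>?I. c k * circ t powi (k - j)) has_integral
      (\<Sum>k\<in>?I. c k * (if k - j = 0 then 1 else 0))) {0..1}"
    by (intro has_integral_sum has_integral_mult_right has_integral_circ_powi) simp
  also have "(\<Sum>k\<in>?I. c k * (if k - j = 0 then 1 else 0)) = c j"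
    using j by (simp add: if_distrib[of "(*) _"] cong: if_cong)
  also have "(\<lambda>t. \<Sum>k\<in>?I. c k * circ t powi (k - j)) = (\<lambda>t. f (circ t) * circ t powi (- j))"
    by (simp add: f sum_divide_distrib power_int_diff power_int_minus divide_inverse[symmetric] nz)
  finally have int: "((\<lambda>t. f (circ t) * circ t powi (- j)) has_integral c j) (cbox 0 1)"
    by simp
  have "0 \<le> B" using order_trans[OF norm_ge_zero B[of 1]] by simp
  from has_integral_bound[OF this int] show ?thesis
    using B by (simp add: norm_mult norm_power_int)
qed

context
  fixes u :: "'a::unital_cstar_algebra"
  assumes u: "unitary u"
begin

lemma zpow_add_one: "zpow u (k + 1) = u * zpow u k"
proof (cases "0 \<le> k")
  case True
  thus ?thesis by (simp add: zpow_def nat_add_distrib)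
next
  case False
  hence "nat (- k) = Suc (nat (- (k + 1)))" by simp
  hence "u * zpow u k = (u * u\<^sup>\<star>) * (u\<^sup>\<star>) ^ nat (- (k + 1))"
    using False by (simp add: zpow_def mult.assoc)
  thus ?thesis using False u by (auto simp: zpow_def unitary_def)
qed

lemma zpow_minus_one: "zpow u (k - 1) = u\<^sup>\<star> * zpow u k"
proof -
  have "u\<^sup>\<star> * zpow u k = (u\<^sup>\<star> * u) * zpow u (k - 1)"
    using zpow_add_one[of "k - 1"] by (simp add: mult.assoc)
  thus ?thesis using u by (simp add: unitary_def)
qed

lemma zpow_add: "zpow u (j + k) = zpow u j * zpow u k"
proof (induction j rule: int_induct[of _ 0])
  case (step1 j)
  have "zpow u (j + 1 + k) = u * zpow u (j + k)"
    by (metis zpow_add_one add.commute add.left_commute)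
  thus ?case by (simp add: step1 zpow_add_one mult.assoc)
next
  case (step2 j)
  have "zpow u (j - 1 + k) = u\<^sup>\<star> * zpow u (j + k)"
    by (metis zpow_minus_one diff_add_eq)
  thus ?case by (simp add: step2 zpow_minus_one mult.assoc)
qed simp

lemma norm_zpow: "norm (zpow u k) = 1"
  by (rule norm_isometry) (simp add: adj_zpow flip: zpow_add)

lemma laurent_mult:
  assumes "laurent u d f x" "laurent u e g y"
  shows "laurent u (d + e) (\<lambda>z. f z * g z) (x * y)"
proof -
  from assms obtain c c' where
    f: "\<And>z. z \<in> sphere 0 1 \<Longrightarrow> f z = (\<Sum>k=-int d..int d. c k * z powi k)" and
    x: "x = (\<Sum>k=-int d..int d. c k *\<^sub>C zpow u k)" and
    g: "\<And>z. z \<in> sphere 0 1 \<Longrightarrow> g z = (\<Sum>k=-int e..int e. c' k * z powi k)" and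
    y: "y = (\<Sum>k=-int e..int e. c' k *\<^sub>C zpow u k)"
    unfolding laurent_def by blast
  have "laurent u (d + e) (\<lambda>z. \<Sum>k=-int d..int d. \<Sum>l=-int e..int e. (c k * c' l) * z powi (k + l))
      (\<Sum>k=-int d..int d. \<Sum>l=-int e..int e. (c k * c' l) *\<^sub>C zpow u (k + l))"
    by (intro laurent_sum laurent_monomial) auto
  also have "(\<Sum>k=-int d..int d. \<Sum>l=-int e..int e. (c k * c' l) *\<^sub>C zpow u (k + l)) = x * y"
    by (simp add: x y sum_product scaleC_mult_scaleC zpow_add)
  finally show ?thesis
  proof (rule laurent_cong)
    fix z :: complex assume z: "z \<in> sphere 0 1"
    hence nz: "z \<noteq> 0" by auto
    show "(\<Sum>k=-int d..int d. \<Sum>l=-int e..int e. (c k * c' l) * z powi (k + l)) = f z * g z"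
      unfolding f[OF z] g[OF z] sum_product using nz
      by (intro sum.cong refl) (simp add: power_int_add mult_ac)
  qed
qed

lemma laurent_power: "laurent u d f x \<Longrightarrow> laurent u (n * d) (\<lambda>z. f z ^ n) (x ^ n)"
proof (induction n)
  case (Suc n)
  from laurent_mult[OF Suc.prems Suc.IH[OF Suc.prems]] show ?case by (simp add: mult.commute)
qed (simp add: laurent_one)

lemma laurent_adj:
  assumes "laurent u d f x"
  shows "laurent u d (\<lambda>z. cnj (f z)) (x\<^sup>\<star>)"
proof -
  from assms obtain c where
    f: "\<And>z. z \<in> sphere 0 1 \<Longrightarrow> f z = (\<Sum>k=-int d..int d. c k * z powi k)" and
    x: "x = (\<Sum>k=-int d..int d. c k *\<^sub>C zpow u k)"
    unfolding laurent_def by blast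
  have "laurent u d (\<lambda>z. \<Sum>k=-int d..int d. cnj (c k) * z powi (- k)) (x\<^sup>\<star>)"
    unfolding x by (simp add: adj_sum adj_scaleC adj_zpow) (intro laurent_sum laurent_monomial; auto)
  thus ?thesis
  proof (rule laurent_cong)
    fix z :: complex assume z: "z \<in> sphere 0 1"
    hence "cnj z * z = 1" by (simp add: complex_norm_square[symmetric] mult.commute)
    hence "cnj z = inverse z" by (metis inverse_unique mult.commute)
    thus "(\<Sum>k=-int d..int d. cnj (c k) * z powi (- k)) = cnj (f z)"
      by (simp add: f[OF z] cnj_sum power_int_minus power_int_inverse flip: power_int_inverse)
  qed
qed

lemma norm_laurent_le_degree:
  assumes "laurent u d f x" and B: "\<And>z. z \<in> sphere 0 1 \<Longrightarrow> norm (f z) \<le> B"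
  shows "norm x \<le> (2 * real d + 1) * B"
proof -
  from assms obtain c where
    f: "\<And>z. z \<in> sphere 0 1 \<Longrightarrow> f z = (\<Sum>k=-int d..int d. c k * z powi k)" and
    x: "x = (\<Sum>k=-int d..int d. c k *\<^sub>C zpow u k)"
    unfolding laurent_def by blast
  have "norm x \<le> (\<Sum>k=-int d..int d. norm (c k *\<^sub>C zpow u k))"
    unfolding x by (rule norm_sum)
  also have "\<dots> \<le> (\<Sum>k=-int d..int d. B)"
    using norm_laurent_coeff_le[OF f B] by (intro sum_mono) (simp add: norm_scaleC norm_zpow)
  finally show ?thesis by simp
qed

text \<open>
  The crude bound loses a factor linear in the degree; applied to the powers of \<open>x\<^sup>\<star> * x\<close>,
  which have norm \<open>norm x ^ (2 * n)\<close> for \<open>n\<close> a power of two, it gives the sharp one.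
\<close>

lemma norm_laurent_le:
  assumes x: "laurent u d f x" and B: "\<And>z. z \<in> sphere 0 1 \<Longrightarrow> norm (f z) \<le> B"
  shows "norm x \<le> B"
proof -
  have B0: "0 \<le> B" using order_trans[OF norm_ge_zero B[of 1]] by simp
  define h where "h = x\<^sup>\<star> * x"
  have h: "laurent u (d + d) (\<lambda>z. cnj (f z) * f z) h"
    unfolding h_def by (intro laurent_mult laurent_adj x)
  have h_adj: "h\<^sup>\<star> = h" by (simp add: h_def adj_mult adj_adj)
  have "norm h \<le> B\<^sup>2"
  proof (rule le_of_power_le_linear)
    fix k :: nat
    have "norm (h ^ (2 ^ k)) \<le> (2 * real (2 ^ k * (d + d)) + 1) * (B\<^sup>2) ^ (2 ^ k)"
    proof (rule norm_laurent_le_degree[OF laurent_power[OF h]])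
      fix z :: complex assume z: "z \<in> sphere 0 1"
      have "norm (cnj (f z) * f z) \<le> B\<^sup>2"
        using B[OF z] by (simp add: norm_mult power2_eq_square mult_mono')
      thus "norm ((cnj (f z) * f z) ^ 2 ^ k) \<le> (B\<^sup>2) ^ (2 ^ k)"
        by (simp only: norm_power power_mono norm_ge_zero)
    qed
    thus "norm h ^ (2 ^ k) \<le> (4 * real d * 2 ^ k + 1) * (B\<^sup>2) ^ (2 ^ k)"
      by (simp add: norm_self_adjoint_power[OF h_adj] mult_ac)
  qed simp_all
  hence "(norm x)\<^sup>2 \<le> B\<^sup>2" by (simp add: h_def cstar_identity)
  thus ?thesis using B0 by simp
qed

end

section \<open>Continuous functional calculus of a unitary\<close>

text \<open>
  The closure of the graph of evaluation of Laurent polynomials at \<open>u\<close>. For unitary \<open>u\<close> it is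
  the graph of a *-homomorphism on the continuous functions on the circle; working with the graph
  avoids choosing values.
\<close>

definition calc :: "'a::unital_cstar_algebra \<Rightarrow> (complex \<Rightarrow> complex) \<Rightarrow> 'a \<Rightarrow> bool" where
  "calc u f x \<longleftrightarrow> (\<exists>g y. (\<forall>n. \<exists>d. laurent u d (g n) (y n)) \<and>
     uniform_limit (sphere 0 1) g f sequentially \<and> y \<longlonglongrightarrow> x)"

lemma continuous_on_laurent:
  assumes "laurent u d f x"
  shows "continuous_on (sphere 0 1) f"
proof -
  from assms obtain c where
    f: "\<And>z. z \<in> sphere 0 1 \<Longrightarrow> f z = (\<Sum>k=-int d..int d. c k * z powi k)"
    unfolding laurent_def by blast
  have "continuous_on (sphere 0 1) (\<lambda>z. \<Sum>k=-int d..int d. c k * z powi k)"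
    by (intro continuous_intros) auto
  thus ?thesis using f by (subst continuous_on_cong[OF refl f]) auto
qed

lemma calc_continuous: "calc u f x \<Longrightarrow> continuous_on (sphere 0 1) f"
  unfolding calc_def
  by (metis (no_types, lifting) uniform_limit_theorem continuous_on_laurent
      always_eventually trivial_limit_sequentially)

lemma bounded_image_circle:
  "continuous_on (sphere 0 1) f \<Longrightarrow> bounded (f ` sphere 0 (1::real))"
  for f :: "complex \<Rightarrow> complex"
  by (intro compact_imp_bounded compact_continuous_image) auto

lemma calc_laurent: "laurent u d f x \<Longrightarrow> calc u f x"
  unfolding calc_def
  by (intro exI[of _ "\<lambda>_. f"] exI[of _ "\<lambda>_. x"] conjI allI exI[of _ d] uniform_limit_const tendsto_const)

lemma calc_cong: "calc u f x \<Longrightarrow> (\<And>z. z \<in> sphere 0 1 \<Longrightarrow> f z = g z) \<Longrightarrow> calc u g x"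
  unfolding calc_def using uniform_limit_cong'[of "sphere 0 1" _ _ f g, OF refl] by blast

lemma calc_add:
  assumes "calc u f x" "calc u g y"
  shows "calc u (\<lambda>z. f z + g z) (x + y)"
proof -
  from assms obtain F X G Y where
    F: "\<And>n. \<exists>d. laurent u d (F n) (X n)" "uniform_limit (sphere 0 1) F f sequentially" "X \<longlonglongrightarrow> x" and
    G: "\<And>n. \<exists>d. laurent u d (G n) (Y n)" "uniform_limit (sphere 0 1) G g sequentially" "Y \<longlonglongrightarrow> y"
    unfolding calc_def by metis
  show ?thesis
    unfolding calc_def
    by (intro exI[of _ "\<lambda>n z. F n z + G n z"] exI[of _ "\<lambda>n. X n + Y n"] conjI allI
        uniform_limit_add tendsto_add F G) (metis F(1) G(1) laurent_add_any)
qed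

lemma calc_const: "calc u (\<lambda>z. c) (c *\<^sub>C 1)"
  using calc_laurent[OF laurent_monomial[of 0 0 u c]] by simp

lemma calc_id: "calc u (\<lambda>z. z) u"
  using calc_laurent[OF laurent_monomial[of 1 1 u 1]] by simp

text \<open>
  Where evaluation of Laurent polynomials does not decrease norms, convergence of their values in
  the algebra forces uniform convergence of the functions, so limits of values are again values.
\<close>

lemma calc_limit:
  assumes laurent: "\<And>n. laurent u (d n) (g n) (y n)" and y: "y \<longlonglongrightarrow> x"
    and bound: "\<And>m n z. z \<in> sphere 0 1 \<Longrightarrow> norm (g m z - g n z) \<le> norm (y m - y n)"
  shows "\<exists>f. calc u f x"
proof -
  have "uniformly_Cauchy_on (sphere 0 1) g"
    unfolding uniformly_Cauchy_on_def
  proof (intro allI impI)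
    fix e :: real assume "e > 0"
    with LIMSEQ_imp_Cauchy[OF y] obtain M where "\<And>m n. m \<ge> M \<Longrightarrow> n \<ge> M \<Longrightarrow> norm (y m - y n) < e"
      unfolding Cauchy_iff by blast
    thus "\<exists>M. \<forall>z\<in>sphere 0 1. \<forall>m\<ge>M. \<forall>n\<ge>M. dist (g m z) (g n z) < e"
      unfolding dist_norm by (intro exI[of _ M] ballI allI impI le_less_trans[OF bound])
  qed
  then obtain f where "uniform_limit (sphere 0 1) g f sequentially"
    using Cauchy_uniformly_convergent uniformly_convergent_on_def by blast
  thus ?thesis unfolding calc_def using laurent y by blast
qed

context
  fixes u :: "'a::unital_cstar_algebra"
  assumes u: "unitary u"
begin

lemma calc_mult:
  assumes "calc u f x" "calc u g y"
  shows "calc u (\<lambda>z. f z * g z) (x * y)"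
proof -
  from assms obtain F X G Y where
    F: "\<And>n. \<exists>d. laurent u d (F n) (X n)" "uniform_limit (sphere 0 1) F f sequentially" "X \<longlonglongrightarrow> x" and
    G: "\<And>n. \<exists>d. laurent u d (G n) (Y n)" "uniform_limit (sphere 0 1) G g sequentially" "Y \<longlonglongrightarrow> y"
    unfolding calc_def by metis
  have "bounded (f ` sphere 0 1)" "bounded (g ` sphere 0 1)"
    using assms by (auto intro: bounded_image_circle calc_continuous)
  thus ?thesis
    unfolding calc_def
    by (intro exI[of _ "\<lambda>n z. F n z * G n z"] exI[of _ "\<lambda>n. X n * Y n"] conjI allI
        uniform_lim_mult tendsto_mult F G) (metis F(1) G(1) laurent_mult[OF u])
qed

lemma calc_scale: "calc u f x \<Longrightarrow> calc u (\<lambda>z. c * f z) (c *\<^sub>C x)"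
  using calc_mult[OF calc_const[of u c]] by (simp add: mult_scaleC_left)

lemma calc_diff: "calc u f x \<Longrightarrow> calc u g y \<Longrightarrow> calc u (\<lambda>z. f z - g z) (x - y)"
  using calc_add[of u f x "\<lambda>z. (- 1) * g z" "(- 1) *\<^sub>C y"] calc_scale[of g y "- 1"]
  by (simp add: scaleC.minus_left)

lemma calc_adj:
  assumes "calc u f x"
  shows "calc u (\<lambda>z. cnj (f z)) (x\<^sup>\<star>)"
proof -
  from assms obtain F X where
    F: "\<And>n. \<exists>d. laurent u d (F n) (X n)" "uniform_limit (sphere 0 1) F f sequentially" "X \<longlonglongrightarrow> x"
    unfolding calc_def by metis
  show ?thesis
    unfolding calc_def
    by (intro exI[of _ "\<lambda>n z. cnj (F n z)"] exI[of _ "\<lambda>n. (X n)\<^sup>\<star>"] conjI allI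
        bounded_linear.uniform_limit[OF bounded_linear_cnj]
        bounded_linear.tendsto[OF bounded_linear_adj] F) (metis F(1) laurent_adj[OF u])
qed

lemma norm_calc_le:
  assumes "calc u f x" and B: "\<And>z. z \<in> sphere 0 1 \<Longrightarrow> norm (f z) \<le> B"
  shows "norm x \<le> B"
proof (rule field_le_epsilon)
  fix e :: real assume e: "e > 0"
  from assms obtain F X where
    F: "\<And>n. \<exists>d. laurent u d (F n) (X n)" "uniform_limit (sphere 0 1) F f sequentially" "X \<longlonglongrightarrow> x"
    unfolding calc_def by metis
  from F(2) e have "eventually (\<lambda>n. \<forall>z\<in>sphere 0 1. dist (F n z) (f z) < e) sequentially"
    by (rule uniform_limitD)
  hence "eventually (\<lambda>n. norm (X n) \<le> B + e) sequentially"
  proof eventually_elim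
    case (elim n)
    obtain d where "laurent u d (F n) (X n)" using F(1) by blast
    thus ?case
    proof (rule norm_laurent_le[OF u])
      fix z :: complex assume z: "z \<in> sphere 0 1"
      show "norm (F n z) \<le> B + e"
        using B[OF z] bspec[OF elim z] norm_triangle_sub[of "F n z" "f z"]
        by (simp add: dist_norm)
    qed
  qed
  thus "norm x \<le> B + e"
    using tendsto_upperbound[OF tendsto_norm[OF F(3)]] by simp
qed

lemma calc_unique:
  assumes "calc u f x" "calc u f y"
  shows "x = y"
  using norm_calc_le[OF calc_diff[OF assms], of 0] by simp

text \<open>
  On the circle the conjugate of \<open>z\<close> is \<open>1 / z\<close>, so a real linear functional is there a Laurent
  polynomial of degree one. Hence real polynomials in the two coordinates are Laurent polynomials,
  and the Stone-Weierstrass theorem applies.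
\<close>

lemma laurent_of_real_polynomial:
  assumes "real_polynomial_function q"
  shows "\<exists>d x. laurent u d (\<lambda>z. of_real (q z)) x"
  using assms
proof induction
  case (linear q)
  define a where "a = (of_real (q 1) - \<i> * of_real (q \<i>)) / 2"
  have "laurent u 1 (\<lambda>z. a * z powi 1 + cnj a * z powi (- 1)) (a *\<^sub>C zpow u 1 + cnj a *\<^sub>C zpow u (- 1))"
    by (intro laurent_add laurent_monomial) auto
  hence "laurent u 1 (\<lambda>z. of_real (q z)) (a *\<^sub>C zpow u 1 + cnj a *\<^sub>C zpow u (- 1))"
  proof (rule laurent_cong)
    fix z :: complex assume z: "z \<in> sphere 0 1"
    interpret q: bounded_linear q by fact
    have "q z = q (Re z *\<^sub>R 1 + Im z *\<^sub>R \<i>)"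
      by (rule arg_cong[of _ _ q]) (simp add: complex_eq_iff)
    hence qz: "q z = Re z * q 1 + Im z * q \<i>" by (simp only: q.add q.scaleR) simp
    have "cnj z * z = 1" using z by (simp add: complex_norm_square[symmetric] mult.commute)
    hence "inverse z = cnj z" by (metis inverse_unique mult.commute)
    hence "a * z powi 1 + cnj a * z powi (- 1) = a * z + cnj a * cnj z"
      by (simp add: power_int_minus)
    also have "\<dots> = of_real (q z)"
      by (simp add: qz a_def complex_eq_iff field_simps)
    finally show "a * z powi 1 + cnj a * z powi (- 1) = of_real (q z)" .
  qed
  thus ?case by blast
next
  case (const c)
  show ?case using laurent_monomial[of 0 0 u "of_real c"] by auto
next
  case (add f g)
  thus ?case using laurent_add_any by fastforce
next
  case (mult f g)
  thus ?case using laurent_mult[OF u] by fastforce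
qed

lemma calc_total:
  assumes f: "continuous_on (sphere 0 1) f"
  shows "\<exists>x. calc u f x"
proof -
  have "\<exists>g d y. (\<forall>z\<in>sphere 0 1. norm (f z - g z) < e) \<and> laurent u d g y" if e: "e > 0" for e
  proof -
    have "compact (sphere 0 1 :: complex set)" by simp
    then obtain p where p: "polynomial_function p" "\<forall>z\<in>sphere 0 1. norm (f z - p z) < e"
      using Stone_Weierstrass_polynomial_function[OF _ f e] by blast
    from p(1) have "real_polynomial_function (Re \<circ> p)" "real_polynomial_function (Im \<circ> p)"
      unfolding polynomial_function_def using bounded_linear_Re bounded_linear_Im by blast+
    then obtain d x d' y where
      "laurent u d (\<lambda>z. of_real ((Re \<circ> p) z)) x" "laurent u d' (\<lambda>z. of_real ((Im \<circ> p) z)) y"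
      using laurent_of_real_polynomial by metis
    moreover have "laurent u 0 (\<lambda>z. \<i>) (\<i> *\<^sub>C 1)"
      using laurent_monomial[of 0 0 u \<i>] by simp
    ultimately have "laurent u (d + (0 + d'))
        (\<lambda>z. of_real ((Re \<circ> p) z) + \<i> * of_real ((Im \<circ> p) z)) (x + \<i> *\<^sub>C 1 * y)"
      by (intro laurent_add_any laurent_mult[OF u])
    hence "laurent u (d + (0 + d')) p (x + \<i> *\<^sub>C 1 * y)"
      by (rule laurent_cong) (simp add: complex_eq_iff)
    with p(2) show ?thesis by blast
  qed
  hence "\<forall>n. \<exists>g d y. (\<forall>z\<in>sphere 0 1. norm (f z - g z) < inverse (real (Suc n))) \<and> laurent u d g y"
    by simp
  then obtain g d y where g: "\<And>n z. z \<in> sphere 0 1 \<Longrightarrow> norm (f z - g n z) < inverse (real (Suc n))"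
    and y: "\<And>n. laurent u (d n) (g n) (y n)"
    by metis
  have "Cauchy y"
    unfolding Cauchy_iff
  proof (intro allI impI)
    fix e :: real assume "e > 0"
    then obtain N where N: "inverse (real (Suc N)) < e / 2"
      using reals_Archimedean[of "e / 2"] by auto
    have "norm (y m - y n) < e" if mn: "m \<ge> N" "n \<ge> N" for m n
    proof -
      have "norm (y m - y n) \<le> 2 * inverse (real (Suc N))"
      proof (rule norm_calc_le[OF calc_diff[OF calc_laurent[OF y] calc_laurent[OF y]]])
        fix z :: complex assume z: "z \<in> sphere 0 1"
        have "inverse (real (Suc m)) \<le> inverse (real (Suc N))"
          "inverse (real (Suc n)) \<le> inverse (real (Suc N))"
          using mn by (intro le_imp_inverse_le; simp)+
        moreover have "norm (g m z - g n z) \<le> norm (f z - g n z) + norm (f z - g m z)"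
          using norm_triangle_ineq4[of "f z - g n z" "f z - g m z"] by simp
        ultimately show "norm (g m z - g n z) \<le> 2 * inverse (real (Suc N))"
          using g[OF z, of m] g[OF z, of n] by linarith
      qed
      thus ?thesis using N by linarith
    qed
    thus "\<exists>M. \<forall>m\<ge>M. \<forall>n\<ge>M. norm (y m - y n) < e" by blast
  qed
  then obtain x where "y \<longlonglongrightarrow> x"
    using Cauchy_convergent convergent_def by blast
  moreover have "uniform_limit (sphere 0 1) g f sequentially"
  proof (rule uniform_limitI)
    fix e :: real assume "e > 0"
    with LIMSEQ_inverse_real_of_nat have "\<forall>\<^sub>F n in sequentially. inverse (real (Suc n)) < e"
      by (rule order_tendstoD)
    thus "\<forall>\<^sub>F n in sequentially. \<forall>z\<in>sphere 0 1. dist (g n z) (f z) < e"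
      by eventually_elim (use g in \<open>force simp: dist_norm norm_minus_commute intro: less_trans\<close>)
  qed
  ultimately show ?thesis unfolding calc_def using y by blast
qed

end

text \<open>
  A unitary for which evaluation of Laurent polynomials is isometric for the supremum norm on
  the circle; equivalently, a unitary whose spectrum is the whole circle.
\<close>

definition full_unitary :: "'a::unital_cstar_algebra \<Rightarrow> bool" where
  "full_unitary u \<longleftrightarrow> unitary u \<and>
     (\<forall>d f x z. laurent u d f x \<longrightarrow> z \<in> sphere 0 1 \<longrightarrow> norm (f z) \<le> norm x)"

lemma norm_calc_ge:
  assumes u: "full_unitary u" and x: "calc u f x" and z: "z \<in> sphere 0 1"
  shows "norm (f z) \<le> norm x"
proof -
  from x obtain F X where
    F: "\<And>n. \<exists>d. laurent u d (F n) (X n)" "uniform_limit (sphere 0 1) F f sequentially" "X \<longlonglongrightarrow> x"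
    unfolding calc_def by metis
  have "(\<lambda>n. F n z) \<longlonglongrightarrow> f z" using F(2) z by (rule tendsto_uniform_limitI)
  moreover have "norm (F n z) \<le> norm (X n)" for n
    using F(1)[of n] u z unfolding full_unitary_def by blast
  ultimately show ?thesis
    using F(3) by (intro LIMSEQ_le[OF tendsto_norm tendsto_norm]) auto
qed

text \<open>
  Evaluation is isometric, so its image, the C*-algebra generated by \<open>u\<close>, consists of values of
  continuous functions.
\<close>

lemma calc_of_closure:
  assumes u: "full_unitary u" and x: "x \<in> closure {y. \<exists>d f. laurent u d f y}"
  shows "\<exists>f. calc u f x"
proof -
  from x obtain y where y: "\<And>n. y n \<in> {y. \<exists>d f. laurent u d f y}" "y \<longlonglongrightarrow> x"
    unfolding closure_sequential by blast
  then obtain d g where g: "\<And>n. laurent u (d n) (g n) (y n)" by simp metis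
  show ?thesis
  proof (rule calc_limit[OF g y(2)])
    fix m n and z :: complex assume z: "z \<in> sphere 0 1"
    have "calc u (\<lambda>z. g m z - g n z) (y m - y n)"
      using u by (intro calc_diff calc_laurent[OF g]) (simp add: full_unitary_def)
    from norm_calc_ge[OF u this z] show "norm (g m z - g n z) \<le> norm (y m - y n)" .
  qed
qed

text \<open>
  If \<open>u - z\<close> had a left inverse \<open>b\<close>, then \<open>norm g \<le> norm b * norm ((w - z) g)\<close> for every
  continuous \<open>g\<close>, which fails for bumps \<open>g\<close> of height one concentrated at \<open>z\<close>.
\<close>

lemma spectrum_full_unitary:
  assumes u: "full_unitary u"
  shows "spectrum u = sphere 0 1"
proof -
  have uu: "unitary u" using u by (simp add: full_unitary_def)
  have id_minus: "calc u (\<lambda>w. w - z) (u - z *\<^sub>C 1)" for z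
    by (intro calc_diff[OF uu] calc_id calc_const)
  have "z \<in> sphere 0 1" if "z \<in> spectrum u" for z
  proof (rule ccontr)
    assume z: "z \<notin> sphere 0 1"
    hence nz: "w - z \<noteq> 0" if "w \<in> sphere 0 1" for w using that by auto
    hence "continuous_on (sphere 0 1) (\<lambda>w. inverse (w - z))"
      by (intro continuous_intros) auto
    then obtain b where b: "calc u (\<lambda>w. inverse (w - z)) b"
      using calc_total[OF uu] by blast
    have one: "calc u (\<lambda>w. 1) 1" using calc_const[of u 1] by simp
    have "calc u (\<lambda>w. 1) (b * (u - z *\<^sub>C 1))" "calc u (\<lambda>w. 1) ((u - z *\<^sub>C 1) * b)"
      using nz by (auto intro: calc_cong[OF calc_mult[OF uu b id_minus]]
          calc_cong[OF calc_mult[OF uu id_minus b]])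
    hence "b * (u - z *\<^sub>C 1) = 1" "(u - z *\<^sub>C 1) * b = 1"
      using calc_unique[OF uu one] by metis+
    thus False using that by (auto simp: spectrum_def)
  qed
  moreover have "z \<in> spectrum u" if z: "z \<in> sphere 0 1" for z
  proof (rule ccontr)
    assume "z \<notin> spectrum u"
    then obtain b where b: "b * (u - z *\<^sub>C 1) = 1" by (auto simp: spectrum_def)
    define M where "M = norm b + 1"
    have M: "M > norm b" "M > 0" by (auto simp: M_def add_nonneg_pos)
    define g where "g w = complex_of_real (max 0 (1 - M * norm (w - z)))" for w
    have "continuous_on (sphere 0 1) g"
      unfolding g_def by (intro continuous_intros)
    then obtain x where x: "calc u g x" using calc_total[OF uu] by blast
    (* On the support of g the factor w - z is at most 1 / M. *)
    have "norm ((u - z *\<^sub>C 1) * x) \<le> 1 / M"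
    proof (rule norm_calc_le[OF uu calc_mult[OF uu id_minus x]])
      fix w
      have t: "t * max 0 (1 - M * t) \<le> 1 / M" if "t \<ge> 0" for t
      proof (cases "M * t \<le> 1")
        case True
        have "t * (1 - M * t) \<le> t" using that M by (intro mult_left_le) auto
        moreover have "t \<le> 1 / M" using True M by (simp add: field_simps)
        ultimately show ?thesis using True by simp
      qed (use M in auto)
      show "norm ((w - z) * g w) \<le> 1 / M"
        using t[of "norm (w - z)"] by (simp add: g_def norm_mult)
    qed
    moreover have "1 \<le> norm x"
      using norm_calc_ge[OF u x z] by (simp add: g_def)
    moreover have "norm x \<le> norm b * norm ((u - z *\<^sub>C 1) * x)"
      using norm_mult_ineq[of b "(u - z *\<^sub>C 1) * x"] b by (simp flip: mult.assoc)
    ultimately have "1 \<le> norm b * (1 / M)"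
      using mult_left_mono[of "norm ((u - z *\<^sub>C 1) * x)" "1 / M" "norm b"] by simp
    thus False using M by (simp add: field_simps)
  qed
  ultimately show ?thesis by blast
qed

lemma is_functional_calculus_calc:
  assumes u: "full_unitary u"
  shows "is_functional_calculus u (\<lambda>f. THE x. calc u f x)"
proof -
  have uu: "unitary u" using u by (simp add: full_unitary_def)
  have eq: "(THE x. calc u f x) = x" if "calc u f x" for f x
    using that calc_unique[OF uu] by blast
  have ex: "calc u f (THE x. calc u f x)" if "continuous_on (sphere 0 1) f" for f
    using calc_total[OF uu that] eq by metis
  have "(THE x. calc u f x) = (THE x. calc u g x)"
    if "continuous_on (sphere 0 1) f" "\<forall>z\<in>sphere 0 1. f z = g z" for f g
    using eq[OF calc_cong[OF ex[OF that(1)], of g]] that(2) by simp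
  moreover have "(THE x. calc u (\<lambda>z. 1) x) = 1"
    using eq[OF calc_const[of u 1]] by simp
  ultimately show ?thesis
    unfolding is_functional_calculus_def Let_def spectrum_full_unitary[OF u]
    by (intro conjI ballI allI impI)
      (simp_all only: mem_Collect_eq eq[OF calc_add[OF ex ex]] eq[OF calc_mult[OF uu ex ex]]
        eq[OF calc_scale[OF uu ex]] eq[OF calc_adj[OF uu ex]] eq[OF calc_id])
qed

lemma is_functional_calculusD:
  fixes a :: "'a::unital_cstar_algebra"
  assumes \<Phi>: "is_functional_calculus a \<Phi>"
    and f: "continuous_on (spectrum a) f"
  shows functional_calculus_add:
      "continuous_on (spectrum a) g \<Longrightarrow> \<Phi> (\<lambda>z. f z + g z) = \<Phi> f + \<Phi> g"
    and functional_calculus_mult: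
      "continuous_on (spectrum a) g \<Longrightarrow> \<Phi> (\<lambda>z. f z * g z) = \<Phi> f * \<Phi> g"
    and functional_calculus_scale: "\<Phi> (\<lambda>z. c * f z) = c *\<^sub>C \<Phi> f"
    and functional_calculus_adj: "\<Phi> (\<lambda>z. cnj (f z)) = (\<Phi> f)\<^sup>\<star>"
    and functional_calculus_cong: "continuous_on (spectrum a) g \<Longrightarrow>
      (\<And>z. z \<in> spectrum a \<Longrightarrow> f z = g z) \<Longrightarrow> \<Phi> f = \<Phi> g"
    and functional_calculus_one: "\<Phi> (\<lambda>z. 1) = 1"
    and functional_calculus_id: "\<Phi> (\<lambda>z. z) = a"
proof -
  note D = \<Phi>[unfolded is_functional_calculus_def Let_def Ball_def mem_Collect_eq]
  note D1 = D[THEN conjunct2] note D2 = D1[THEN conjunct2] note D3 = D2[THEN conjunct2]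
  note D4 = D3[THEN conjunct2] note D5 = D4[THEN conjunct2] note D6 = D5[THEN conjunct2]
  show "\<Phi> (\<lambda>z. f z + g z) = \<Phi> f + \<Phi> g" if "continuous_on (spectrum a) g"
    by (rule D[THEN conjunct1, rule_format]) (fact f that)+
  show "\<Phi> (\<lambda>z. f z * g z) = \<Phi> f * \<Phi> g" if "continuous_on (spectrum a) g"
    by (rule D1[THEN conjunct1, rule_format]) (fact f that)+
  show "\<Phi> (\<lambda>z. c * f z) = c *\<^sub>C \<Phi> f"
    by (rule D2[THEN conjunct1, rule_format]) (fact f)
  show "\<Phi> (\<lambda>z. cnj (f z)) = (\<Phi> f)\<^sup>\<star>"
    by (rule D3[THEN conjunct1, rule_format]) (fact f)
  show "\<Phi> f = \<Phi> g" if "continuous_on (spectrum a) g" "\<And>z. z \<in> spectrum a \<Longrightarrow> f z = g z"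
    by (rule D6[rule_format]) (fact f that)+
  show "\<Phi> (\<lambda>z. 1) = 1" by (fact D4[THEN conjunct1])
  show "\<Phi> (\<lambda>z. z) = a" by (fact D5[THEN conjunct1])
qed

text \<open>
  A functional calculus is automatically contractive: a real function \<open>g\<close> with values in
  \<open>[0, 1]\<close> is the real part of the unitary function \<open>g + \<i> sqrt (1 - g\<^sup>2)\<close>. Hence it is
  determined by its values on Laurent polynomials.
\<close>

lemma functional_calculus_contractive:
  fixes a :: "'a::unital_cstar_algebra"
  assumes \<Phi>: "is_functional_calculus a \<Phi>" and f: "continuous_on (spectrum a) f"
    and B: "\<And>z. z \<in> spectrum a \<Longrightarrow> norm (f z) \<le> B" "B > 0"
  shows "norm (\<Phi> f) \<le> B"
proof -
  let ?C = "\<lambda>f. continuous_on (spectrum a) f"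
  note add = functional_calculus_add[OF \<Phi>] and mult = functional_calculus_mult[OF \<Phi>]
    and scale = functional_calculus_scale[OF \<Phi>] and adj = functional_calculus_adj[OF \<Phi>]
    and one = functional_calculus_one[OF \<Phi> f] and cong = functional_calculus_cong[OF \<Phi>]
  (* The real function to write as a real part is the normalised square of the modulus of f. *)
  define r where "r z = (norm (f z) / B)\<^sup>2" for z
  have r: "0 \<le> r z" "r z \<le> 1" if "z \<in> spectrum a" for z
    using B(1)[OF that] B(2) by (auto simp: r_def power_le_one)
  have cr: "continuous_on (spectrum a) r"
    unfolding r_def by (intro continuous_intros f) (use B in auto)
  define v where "v z = complex_of_real (r z) + \<i> * of_real (sqrt (1 - (r z)\<^sup>2))" for z
  have cv: "?C v"
    unfolding v_def by (intro continuous_intros cr)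
  have "(\<Phi> v)\<^sup>\<star> * \<Phi> v = \<Phi> (\<lambda>z. cnj (v z) * v z)"
    using cv by (simp add: mult adj continuous_on_cnj)
  also have "\<dots> = \<Phi> (\<lambda>z. 1)"
  proof (rule cong)
    fix z assume z: "z \<in> spectrum a"
    have "(r z)\<^sup>2 \<le> 1" using r[OF z] by (simp add: power_le_one)
    thus "cnj (v z) * v z = 1"
      by (simp add: v_def complex_eq_iff power2_eq_square[symmetric] real_sqrt_pow2)
  qed (intro continuous_intros continuous_on_cnj cv)+
  finally have nv: "norm (\<Phi> v) = 1" by (simp add: one norm_isometry)
  have cof: "?C (\<lambda>z. complex_of_real (r z))" by (intro continuous_intros cr)
  have "\<Phi> v + (\<Phi> v)\<^sup>\<star> = \<Phi> (\<lambda>z. v z + cnj (v z))"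
    using cv by (simp add: add adj continuous_on_cnj)
  also have "(\<lambda>z. v z + cnj (v z)) = (\<lambda>z. 2 * of_real (r z))"
    by (simp add: v_def fun_eq_iff complex_eq_iff)
  also have "\<Phi> \<dots> = 2 *\<^sub>C \<Phi> (\<lambda>z. of_real (r z))" using scale[OF cof] .
  finally have "norm (2 *\<^sub>C \<Phi> (\<lambda>z. of_real (r z))) \<le> 2"
    using norm_triangle_ineq[of "\<Phi> v" "(\<Phi> v)\<^sup>\<star>"] nv by simp
  hence "norm (\<Phi> (\<lambda>z. of_real (r z))) \<le> 1" by (simp add: norm_scaleC)
  moreover have "(\<Phi> f)\<^sup>\<star> * \<Phi> f = of_real (B\<^sup>2) *\<^sub>C \<Phi> (\<lambda>z. of_real (r z))"
  proof -
    have "(\<Phi> f)\<^sup>\<star> * \<Phi> f = \<Phi> (\<lambda>z. cnj (f z) * f z)"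
      using f by (simp add: mult adj continuous_on_cnj)
    also have "(\<lambda>z. cnj (f z) * f z) = (\<lambda>z. of_real (B\<^sup>2) * of_real (r z))"
    proof
      fix z
      have "B\<^sup>2 * r z = (norm (f z))\<^sup>2" using B(2) by (simp add: r_def power_divide)
      moreover have "cnj (f z) * f z = of_real ((norm (f z))\<^sup>2)"
        by (simp only: complex_norm_square mult.commute)
      ultimately show "cnj (f z) * f z = of_real (B\<^sup>2) * of_real (r z)"
        by (simp only: flip: of_real_mult)
    qed
    also have "\<Phi> \<dots> = of_real (B\<^sup>2) *\<^sub>C \<Phi> (\<lambda>z. of_real (r z))" using scale[OF cof] .
    finally show ?thesis .
  qed
  ultimately have "(norm (\<Phi> f))\<^sup>2 \<le> B\<^sup>2"
    using cstar_identity[of "\<Phi> f"]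
      mult_left_le[of "norm (\<Phi> (\<lambda>z. complex_of_real (r z)))" "B\<^sup>2"]
    by (simp add: norm_scaleC norm_power)
  thus ?thesis using B(2) by simp
qed

text \<open>
  The functional calculus is pinned down on Laurent polynomials by the homomorphism property, and
  on their uniform limits by contractivity. So the definite description of \<open>cfc\<close> succeeds.
\<close>

lemma functional_calculus_eq_calc:
  fixes u :: "'a::unital_cstar_algebra"
  assumes u: "full_unitary u" and \<Phi>: "is_functional_calculus u \<Phi>" and x: "calc u f x"
  shows "\<Phi> f = x"
proof -
  let ?T = "sphere 0 1 :: complex set"
  have uu: "unitary u" using u by (simp add: full_unitary_def)
  note sp = spectrum_full_unitary[OF u]
  let ?C = "\<lambda>f. continuous_on ?T f"
  have cf: "?C f" using x by (rule calc_continuous)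
  note add = functional_calculus_add[OF \<Phi>, unfolded sp]
    and mult = functional_calculus_mult[OF \<Phi>, unfolded sp]
    and scale = functional_calculus_scale[OF \<Phi>, unfolded sp]
    and adj = functional_calculus_adj[OF \<Phi>, unfolded sp]
    and cong = functional_calculus_cong[OF \<Phi>, unfolded sp]
    and one = functional_calculus_one[OF \<Phi>, unfolded sp, OF cf]
    and id = functional_calculus_id[OF \<Phi>, unfolded sp, OF cf]
  have cpow: "?C (\<lambda>z. z powi k)" for k by (intro continuous_intros) auto
  have pow: "\<Phi> (\<lambda>z. z ^ n) = u ^ n" for n
    by (induction n) (simp_all add: one mult id continuous_on_power)
  have powi: "\<Phi> (\<lambda>z. z powi k) = zpow u k" for k
  proof (cases "0 \<le> k")
    case True
    thus ?thesis using pow[of "nat k"] by (simp add: zpow_def power_int_def)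
  next
    case False
    have "\<Phi> (\<lambda>z. z powi k) = \<Phi> (\<lambda>z. cnj (z ^ nat (- k)))"
    proof (rule cong[OF cpow])
      fix z :: complex assume "z \<in> ?T"
      hence "cnj z * z = 1" by (simp add: complex_norm_square[symmetric] mult.commute)
      hence "inverse z = cnj z" by (metis inverse_unique mult.commute)
      thus "z powi k = cnj (z ^ nat (- k))" using False by (simp add: power_int_def)
    qed (intro continuous_intros)
    also have "\<dots> = (u ^ nat (- k))\<^sup>\<star>"
      by (subst adj) (intro continuous_intros, simp add: pow)
    finally show ?thesis using False by (simp add: zpow_def adj_power)
  qed
  have laur: "\<Phi> g = y" if y: "laurent u d g y" for d g y
  proof -
    from y obtain c where
      g: "\<And>z. z \<in> ?T \<Longrightarrow> g z = (\<Sum>k=-int d..int d. c k * z powi k)" and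
      y_eq: "y = (\<Sum>k=-int d..int d. c k *\<^sub>C zpow u k)"
      unfolding laurent_def by blast
    have zero: "\<Phi> (\<lambda>z. 0) = 0" using scale[of "\<lambda>z. 1" 0] by (simp add: scaleC.zero_left)
    have sum: "\<Phi> (\<lambda>z. \<Sum>k\<in>K. c k * z powi k) = (\<Sum>k\<in>K. c k *\<^sub>C zpow u k)"
      if "finite K" for K
      using that
    proof (induction K rule: finite_induct)
      case (insert k K)
      have "?C (\<lambda>z. c k * z powi k)" "?C (\<lambda>z. \<Sum>k\<in>K. c k * z powi k)"
        by (intro continuous_intros cpow)+
      with insert show ?case by (simp add: add scale cpow powi)
    qed (simp add: zero)
    have "\<Phi> g = \<Phi> (\<lambda>z. \<Sum>k=-int d..int d. c k * z powi k)"
      by (rule cong[OF continuous_on_laurent[OF y] _ g]) (intro continuous_intros cpow)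
    thus ?thesis by (simp add: sum y_eq)
  qed
  from x obtain F X where
    F: "\<And>n. \<exists>d. laurent u d (F n) (X n)" "uniform_limit ?T F f sequentially" "X \<longlonglongrightarrow> x"
    unfolding calc_def by metis
  have "X \<longlonglongrightarrow> \<Phi> f"
  proof (rule LIMSEQ_I)
    fix e :: real assume e: "e > 0"
    have "eventually (\<lambda>n. \<forall>z\<in>?T. dist (F n z) (f z) < e / 2) sequentially"
      using e by (intro uniform_limitD[OF F(2)]) simp
    hence "eventually (\<lambda>n. norm (X n - \<Phi> f) < e) sequentially"
    proof eventually_elim
      case (elim n)
      obtain d where d: "laurent u d (F n) (X n)" using F(1) by blast
      note cF = continuous_on_laurent[OF d]
      have "X n - \<Phi> f = \<Phi> (F n) + (- 1) *\<^sub>C \<Phi> f"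
        by (simp add: laur[OF d] scaleC.minus_left)
      also have "\<dots> = \<Phi> (\<lambda>z. F n z + (- 1) * f z)"
        using add[OF cF, of "\<lambda>z. (- 1) * f z"] scale[OF cf, of "- 1"] cf
        by (simp add: continuous_on_minus)
      also have "norm \<dots> \<le> e / 2"
        using elim e cF cf
        by (intro functional_calculus_contractive[OF \<Phi>])
          (auto simp: sp dist_norm intro!: continuous_intros less_imp_le)
      finally show ?case using e by simp
    qed
    thus "\<exists>N. \<forall>n\<ge>N. norm (X n - \<Phi> f) < e" by (simp add: eventually_sequentially)
  qed
  thus ?thesis using F(3) LIMSEQ_unique by blast
qed

lemma cfc_eq_calc:
  assumes u: "full_unitary u" and x: "calc u f x"
  shows "cfc f u = x"
  unfolding cfc_def
proof (rule the_equality)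
  show "\<exists>\<Phi>. is_functional_calculus u \<Phi> \<and> \<Phi> f = x"
    using is_functional_calculus_calc[OF u] functional_calculus_eq_calc[OF u _ x] by blast
qed (use functional_calculus_eq_calc[OF u _ x] in blast)

section \<open>Consequences of the defining relations\<close>

locale two_adic_pair =
  fixes U S :: "'a::unital_cstar_algebra"
  assumes unitary_U: "unitary U"
    and isometry_S: "S\<^sup>\<star> * S = 1"
    and S_U: "S * U = U\<^sup>2 * S"
    and range_sum: "S * S\<^sup>\<star> + U * S * S\<^sup>\<star> * U\<^sup>\<star> = 1"
begin

abbreviation Z :: "int \<Rightarrow> 'a" where "Z \<equiv> zpow U"

lemmas Z_add = zpow_add[OF unitary_U]
  and norm_Z = norm_zpow[OF unitary_U]

lemma Z_add_left: "Z a * (Z b * x) = Z (a + b) * x"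
  by (simp add: Z_add mult.assoc)

lemma U_adj_U: "U\<^sup>\<star> * U = 1" "U * U\<^sup>\<star> = 1"
  using unitary_U by (auto simp: unitary_def)

lemma S_Z: "S * Z k = Z (2 * k) * S"
proof (induction k rule: int_induct[of _ 0])
  case (step1 k)
  have "S * Z (k + 1) = U\<^sup>2 * (S * Z k)"
    by (metis S_U zpow_add_one[OF unitary_U] mult.assoc)
  also have "\<dots> = (U * (U * Z (2 * k))) * S"
    by (simp add: step1 power2_eq_square mult.assoc)
  also have "U * (U * Z (2 * k)) = Z (2 * (k + 1))"
    by (simp add: algebra_simps flip: zpow_add_one[OF unitary_U])
  finally show ?case .
next
  case (step2 k)
  have "S * Z (k - 1) = Z (- 2) * (Z 2 * S * Z (k - 1))"
    by (simp add: Z_add_left mult.assoc)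
  also have "Z 2 = U\<^sup>2" by (simp add: zpow_def)
  also have "U\<^sup>2 * S * Z (k - 1) = S * Z k"
    by (metis S_U diff_add_cancel zpow_add_one[OF unitary_U] mult.assoc)
  also have "Z (- 2) * (S * Z k) = Z (2 * (k - 1)) * S"
    by (simp add: step2 Z_add_left algebra_simps)
  finally show ?case .
qed simp

lemma S_adj_Z: "S\<^sup>\<star> * Z (2 * k) = Z k * S\<^sup>\<star>"
  using arg_cong[OF S_Z[of "- k"], of adj] by (simp add: adj_mult adj_zpow)

lemma S_power_Z: "S ^ i * Z k = Z (2 ^ i * k) * S ^ i"
proof (induction i arbitrary: k)
  case (Suc i)
  have "S ^ Suc i * Z k = S * (Z (2 ^ i * k) * S ^ i)"
    by (simp add: mult.assoc Suc)
  also have "\<dots> = Z (2 * (2 ^ i * k)) * S ^ Suc i"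
    by (simp only: mult.assoc[symmetric] S_Z power_Suc)
  finally show ?case by (simp add: mult.assoc)
qed simp

lemma S_adj_power_Z: "(S\<^sup>\<star>) ^ i * Z (2 ^ i * k) = Z k * (S\<^sup>\<star>) ^ i"
  using arg_cong[OF S_power_Z[of i "- k"], of adj] by (simp add: adj_mult adj_zpow adj_power)

text \<open>
  The ranges of \<open>S\<close> and \<open>U * S\<close> are orthogonal because the projections onto them sum to one:
  compressing that sum gives \<open>x = x + x\<close> for the element in question.
\<close>

lemma S_adj_U_S: "S\<^sup>\<star> * U * S = 0"
proof -
  have "S\<^sup>\<star> * U * S = S\<^sup>\<star> * (S * S\<^sup>\<star> + U * S * S\<^sup>\<star> * U\<^sup>\<star>) * U * S"
    by (simp add: range_sum)
  also have "\<dots> = (S\<^sup>\<star> * S) * S\<^sup>\<star> * U * S + S\<^sup>\<star> * U * S * S\<^sup>\<star> * (U\<^sup>\<star> * U) * S"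
    by (simp add: algebra_simps)
  also have "\<dots> = S\<^sup>\<star> * U * S + S\<^sup>\<star> * U * S * (S\<^sup>\<star> * S)"
    by (simp only: isometry_S U_adj_U mult_1_left mult_1_right mult.assoc)
  finally show ?thesis by (simp add: isometry_S)
qed

lemma S_adj_Z_S: "S\<^sup>\<star> * Z k * S = (if even k then Z (k div 2) else 0)"
proof (cases "even k")
  case True
  then obtain m where k: "k = 2 * m" by blast
  thus ?thesis by (simp add: S_adj_Z mult.assoc isometry_S)
next
  case False
  then obtain m where k: "k = 2 * m + 1" by (metis oddE)
  have "S\<^sup>\<star> * Z k * S = Z m * (S\<^sup>\<star> * U * S)"
    unfolding k Z_add by (simp add: S_adj_Z flip: mult.assoc)
  thus ?thesis using False by (simp add: S_adj_U_S)
qed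

lemma norm_S: "norm S = 1"
  using isometry_S by (rule norm_isometry)

lemma norm_compress: "norm ((S\<^sup>\<star>) ^ n * x * S ^ n) \<le> norm x"
proof -
  have "norm (S ^ n) \<le> 1" "norm ((S\<^sup>\<star>) ^ n) \<le> 1"
    using norm_power_ineq[of S n] norm_power_ineq[of "S\<^sup>\<star>" n] by (auto simp: norm_S)
  moreover have "norm ((S\<^sup>\<star>) ^ n * x * S ^ n) \<le> norm ((S\<^sup>\<star>) ^ n) * norm x * norm (S ^ n)"
    by (meson norm_mult_ineq mult_right_mono norm_ge_zero order_trans)
  moreover have "\<dots> \<le> 1 * norm x * 1"
    using calculation by (intro mult_mono) auto
  ultimately show ?thesis by simp
qed

text \<open>
  Compressing by \<open>S ^ n\<close> kills every small nonzero power of \<open>U\<close>, so it extracts the constant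
  coefficient of a Laurent polynomial in \<open>U\<close>, without increasing the norm.
\<close>

lemma compress_Z:
  "\<bar>k\<bar> < 2 ^ n \<Longrightarrow> (S\<^sup>\<star>) ^ n * Z k * S ^ n = (if k = 0 then 1 else 0)"
proof (induction n arbitrary: k)
  case (Suc n)
  have "(S\<^sup>\<star>) ^ Suc n * Z k * S ^ Suc n = (S\<^sup>\<star>) ^ n * (S\<^sup>\<star> * Z k * S) * S ^ n"
    by (simp only: power_Suc2[of "S\<^sup>\<star>"] power_Suc[of S] mult.assoc)
  also have "\<dots> = (if k = 0 then 1 else 0)"
  proof (cases "even k")
    case True
    then obtain m where k: "k = 2 * m" by blast
    thus ?thesis using Suc.IH[of m] Suc.prems by (simp add: S_adj_Z_S)
  next
    case False
    thus ?thesis by (auto simp: S_adj_Z_S)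
  qed
  finally show ?case .
qed simp

lemma coefficient_le_norm:
  assumes j: "j \<in> {-int d..int d}"
  shows "norm (c j) \<le> norm (\<Sum>k=-int d..int d. c k *\<^sub>C Z k)"
proof -
  let ?x = "\<Sum>k=-int d..int d. c k *\<^sub>C Z k"
  define n where "n = 2 * d"
  have n: "2 * int d < 2 ^ n"
    unfolding n_def using less_exp[of "2 * d"] by (metis of_nat_less_iff of_nat_mult of_nat_numeral of_nat_power)
  have "(S\<^sup>\<star>) ^ n * (Z (- j) * ?x) * S ^ n =
      (\<Sum>k=-int d..int d. c k *\<^sub>C ((S\<^sup>\<star>) ^ n * Z (k - j) * S ^ n))"
    by (simp add: sum_distrib_left sum_distrib_right mult_scaleC_left mult_scaleC_right flip: Z_add)
  also have "\<dots> = (\<Sum>k=-int d..int d. if k = j then c j *\<^sub>C 1 else 0)"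
    using n j by (intro sum.cong refl) (subst compress_Z, auto simp: scaleC.zero_right)
  also have "\<dots> = c j *\<^sub>C 1" using j by simp
  finally have "norm (c j) \<le> norm (Z (- j) * ?x)"
    using norm_compress[of n "Z (- j) * ?x"] by (simp add: norm_scaleC)
  also have "\<dots> \<le> norm ?x"
    using norm_mult_ineq[of "Z (- j)" ?x] by (simp add: norm_Z)
  finally show ?thesis .
qed

text \<open>
  A Laurent polynomial of degree \<open>d\<close> is bounded by \<open>2 * d + 1\<close> times its largest coefficient;
  as before, taking powers removes the factor.
\<close>

lemma full_unitary_U: "full_unitary U"
  unfolding full_unitary_def
proof (intro conjI allI impI unitary_U)
  fix d f x and z :: complex assume x: "laurent U d f x" and z: "z \<in> sphere 0 1"
  show "norm (f z) \<le> norm x"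
  proof (rule le_of_power_le_linear)
    fix k :: nat
    define N where "N = 2 ^ k * d"
    have "laurent U N (\<lambda>z. f z ^ (2 ^ k)) (x ^ (2 ^ k))"
      unfolding N_def by (rule laurent_power[OF unitary_U x])
    then obtain c where
      f: "f z ^ (2 ^ k) = (\<Sum>l=-int N..int N. c l * z powi l)" and
      xk: "x ^ (2 ^ k) = (\<Sum>l=-int N..int N. c l *\<^sub>C Z l)"
      using z unfolding laurent_def by blast
    have "norm (f z) ^ (2 ^ k) \<le> (\<Sum>l=-int N..int N. norm (c l * z powi l))"
      unfolding norm_power[symmetric] f by (rule norm_sum)
    also have "\<dots> \<le> (\<Sum>l=-int N..int N. norm (x ^ (2 ^ k)))"
      unfolding xk using z
      by (intro sum_mono) (simp add: norm_mult norm_power_int coefficient_le_norm)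
    also have "\<dots> = (2 * real d * 2 ^ k + 1) * norm (x ^ (2 ^ k))"
      by (simp add: N_def mult_ac)
    also have "\<dots> \<le> (2 * real d * 2 ^ k + 1) * norm x ^ (2 ^ k)"
      by (intro mult_left_mono norm_power_ineq) auto
    finally show "norm (f z) ^ (2 ^ k) \<le> (2 * real d * 2 ^ k + 1) * norm x ^ (2 ^ k)" .
  qed simp_all
qed

end

section \<open>Averaging over conjugation by powers of a unitary\<close>

text \<open>\<open>cyc_avg U m x\<close> is the mean of \<open>U ^ k * x * U ^ (- k)\<close> over \<open>0 \<le> k < 2 ^ m\<close>.\<close>

primrec cyc_avg :: "'a::unital_cstar_algebra \<Rightarrow> nat \<Rightarrow> 'a \<Rightarrow> 'a" where
  "cyc_avg U 0 x = x"
| "cyc_avg U (Suc m) x =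
     (1 / 2) *\<^sub>R (cyc_avg U m x + zpow U (2 ^ m) * cyc_avg U m x * zpow U (- (2 ^ m)))"

context two_adic_pair
begin

abbreviation avg :: "nat \<Rightarrow> 'a \<Rightarrow> 'a" where "avg \<equiv> cyc_avg U"

lemma avg_add: "avg m (x + y) = avg m x + avg m y"
  by (induction m) (simp_all add: algebra_simps)

lemma avg_scaleC: "avg m (c *\<^sub>C x) = c *\<^sub>C avg m x"
  by (induction m) (simp_all add: scaleC_add_right mult_scaleC_left mult_scaleC_right
      scaleR_scaleC scaleC_scaleC mult.commute)

lemma avg_diff: "avg m (x - y) = avg m x - avg m y"
  using avg_add[of m "x - y" y] by simp

lemma norm_avg_le: "norm (avg m x) \<le> norm x"
proof (induction m)
  case (Suc m)
  have "norm (Z (2 ^ m) * avg m x * Z (- (2 ^ m))) \<le> norm (avg m x)"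
    using norm_mult_ineq[of "Z (2 ^ m) * avg m x" "Z (- (2 ^ m))"]
      norm_mult_ineq[of "Z (2 ^ m)" "avg m x"] by (simp add: norm_Z)
  hence "norm (avg m x + Z (2 ^ m) * avg m x * Z (- (2 ^ m))) \<le> 2 * norm x"
    using norm_triangle_ineq[of "avg m x" "Z (2 ^ m) * avg m x * Z (- (2 ^ m))"] Suc by linarith
  thus ?case by (simp flip: scaleR_add_right)
qed simp

lemma avg_bimodule: "avg m (Z a * x * Z b) = Z a * avg m x * Z b"
proof (induction m)
  case (Suc m)
  have comm: "Z c * (Z a * y * Z b) * Z (- c) = Z a * (Z c * y * Z (- c)) * Z b" for c y
    by (simp add: mult.assoc Z_add_left add.commute flip: Z_add)
  show ?case
    by (simp only: cyc_avg.simps Suc comm) (simp add: algebra_simps)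
qed simp

lemma Z_commute:
  assumes "x * U = U * x"
  shows "x * Z k = Z k * x"
proof -
  have "x * U\<^sup>\<star> = U\<^sup>\<star> * U * x * U\<^sup>\<star>" by (simp add: U_adj_U)
  also have "\<dots> = U\<^sup>\<star> * (x * U) * U\<^sup>\<star>" by (simp add: assms mult.assoc)
  also have "\<dots> = U\<^sup>\<star> * x" by (simp add: mult.assoc U_adj_U)
  finally have "x * (U\<^sup>\<star>) ^ n = (U\<^sup>\<star>) ^ n * x" for n
    by (metis power_commuting_commutes)
  moreover have "x * U ^ n = U ^ n * x" for n
    using assms by (metis power_commuting_commutes)
  ultimately show ?thesis by (simp add: zpow_def)
qed

lemma avg_of_commuting:
  assumes "x * U = U * x"
  shows "avg m x = x"
proof (induction m)
  case (Suc m)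
  have "Z k * x * Z (- k) = x" for k
    by (simp add: mult.assoc Z_commute[OF assms] Z_add_left)
  thus ?case by (simp add: Suc flip: scaleR_2)
qed simp

text \<open>
  Conjugation by even powers of \<open>U\<close> passes through \<open>S\<close> as conjugation by half the power, so
  \<open>2 ^ Suc m\<close> conjugates of \<open>S * x * S\<^sup>\<star>\<close> split into two families according to parity.
\<close>

lemma avg_conj_S:
  "avg (Suc m) (S * x * S\<^sup>\<star>) =
     (1 / 2) *\<^sub>R (S * avg m x * S\<^sup>\<star> + U * (S * avg m x * S\<^sup>\<star>) * U\<^sup>\<star>)"
proof (induction m)
  case (Suc m)
  define y where "y = avg m x"
  have conj: "Z (2 ^ Suc m) * (S * y * S\<^sup>\<star>) * Z (- (2 ^ Suc m)) =
      S * (Z (2 ^ m) * y * Z (- (2 ^ m))) * S\<^sup>\<star>"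
    using S_Z[of "2 ^ m"] S_adj_Z[of "- (2 ^ m)"] by (simp add: mult.assoc) (simp flip: mult.assoc)
  have "Z (2 ^ Suc m) * (U * (S * y * S\<^sup>\<star>) * U\<^sup>\<star>) * Z (- (2 ^ Suc m)) =
      U * (Z (2 ^ Suc m) * (S * y * S\<^sup>\<star>) * Z (- (2 ^ Suc m))) * U\<^sup>\<star>"
    using Z_add[of "2 ^ Suc m" 1] Z_add[of 1 "2 ^ Suc m"]
      Z_add[of "- (2 ^ Suc m)" "- 1"] Z_add[of "- 1" "- (2 ^ Suc m)"]
    by (simp add: zpow_minus_1 add.commute flip: mult.assoc) (simp add: mult.assoc)
  note conj2 = this[unfolded conj]
  have "avg (Suc (Suc m)) (S * x * S\<^sup>\<star>) = (1 / 2) *\<^sub>R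
      ((1 / 2) *\<^sub>R (S * y * S\<^sup>\<star> + U * (S * y * S\<^sup>\<star>) * U\<^sup>\<star>) +
       (1 / 2) *\<^sub>R (Z (2 ^ Suc m) * (S * y * S\<^sup>\<star>) * Z (- (2 ^ Suc m)) +
         Z (2 ^ Suc m) * (U * (S * y * S\<^sup>\<star>) * U\<^sup>\<star>) * Z (- (2 ^ Suc m))))"
    unfolding cyc_avg.simps(2)[of U "Suc m"] Suc.IH y_def[symmetric]
    by (simp only: distrib_left distrib_right mult_scaleR_left mult_scaleR_right)
  also have "\<dots> = (1 / 2) *\<^sub>R (S * avg (Suc m) x * S\<^sup>\<star> + U * (S * avg (Suc m) x * S\<^sup>\<star>) * U\<^sup>\<star>)"
    unfolding conj conj2 cyc_avg.simps(2)[of U m] y_def[symmetric]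
    by (simp add: algebra_simps)
  finally show ?case .
qed (simp add: zpow_minus_1)

text \<open>
  The conjugates of \<open>S ^ i * S\<^sup>\<star> ^ i\<close> by \<open>U ^ k\<close> for \<open>k < 2 ^ i\<close> are orthogonal projections with
  sum one, which follows by iterating the relation \<open>S * S\<^sup>\<star> + U * S * S\<^sup>\<star> * U\<^sup>\<star> = 1\<close>.
\<close>

lemma avg_projection: "i \<le> m \<Longrightarrow> avg m (S ^ i * (S\<^sup>\<star>) ^ i) = (1 / 2 ^ i) *\<^sub>R 1"
proof (induction i arbitrary: m)
  case 0
  show ?case by (simp add: avg_of_commuting)
next
  case (Suc i)
  then obtain m' where m: "m = Suc m'" "i \<le> m'" by (cases m) auto
  have "S ^ Suc i * (S\<^sup>\<star>) ^ Suc i = S * (S ^ i * (S\<^sup>\<star>) ^ i) * S\<^sup>\<star>"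
    by (simp only: power_Suc[of S] power_Suc2[of "S\<^sup>\<star>"] mult.assoc)
  hence "avg m (S ^ Suc i * (S\<^sup>\<star>) ^ Suc i) =
      (1 / 2) *\<^sub>R ((1 / 2 ^ i) *\<^sub>R (S * S\<^sup>\<star> + U * S * S\<^sup>\<star> * U\<^sup>\<star>))"
    by (simp only: m avg_conj_S Suc.IH[OF m(2)])
      (simp add: algebra_simps)
  thus ?case by (simp add: range_sum)
qed

end

section \<open>The gauge action and its Fourier components\<close>

locale two_adic_ring_algebra =
  fixes U S :: "'a::unital_cstar_algebra"
  assumes is_Q2: "is_Q2 U S"
begin

sublocale two_adic_pair
  using is_Q2 by unfold_locales (auto simp: is_Q2_def)

lemma generated_by_U_S:
  assumes "unital_cstar_subalgebra C" "U \<in> C" "S \<in> C"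
  shows "x \<in> C"
proof -
  have "unital_cstar_subalgebra hull {U, S} \<subseteq> C"
    using assms by (intro hull_minimal) auto
  thus ?thesis using is_Q2 by (auto simp: is_Q2_def)
qed

text \<open>
  The defining relations are invariant under multiplication of \<open>S\<close> by a scalar of modulus one, so
  the universal property provides an action of the circle that fixes \<open>U\<close> and rotates \<open>S\<close>.
\<close>

lemma ex_gauge:
  "\<exists>\<phi>. unital_star_hom \<phi> cstar_of_type \<and> \<phi> U = U \<and> \<phi> S = circ t *\<^sub>C S"
proof -
  have "cnj (circ t) * circ t = 1"
    by (simp add: complex_norm_square[symmetric] mult.commute)
  moreover have "circ t * cnj (circ t) = 1"
    by (simp add: complex_norm_square[symmetric])
  ultimately have "Q2_relations cstar_of_type U (circ t *\<^sub>C S)"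
    using isometry_S S_U range_sum U_adj_U
    by (simp add: Q2_relations_def cstar_of_type_def adj_scaleC mult_scaleC_left
        mult_scaleC_right scaleC_scaleC power2_eq_square)
  thus ?thesis
    using is_Q2 unital_cstar_structure_of_type unfolding is_Q2_def by blast
qed

definition gauge :: "real \<Rightarrow> 'a \<Rightarrow> 'a" where
  "gauge t = (SOME \<phi>. unital_star_hom \<phi> cstar_of_type \<and> \<phi> U = U \<and> \<phi> S = circ t *\<^sub>C S)"

lemma gauge_hom: "unital_star_hom (gauge t) cstar_of_type"
  and gauge_U: "gauge t U = U"
  and gauge_S: "gauge t S = circ t *\<^sub>C S"
  using someI_ex[OF ex_gauge[of t]] unfolding gauge_def by blast+

lemma gauge_add: "gauge t (x + y) = gauge t x + gauge t y"
  and gauge_mult: "gauge t (x * y) = gauge t x * gauge t y"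
  and gauge_scaleC: "gauge t (c *\<^sub>C x) = c *\<^sub>C gauge t x"
  and gauge_adj: "gauge t (x\<^sup>\<star>) = (gauge t x)\<^sup>\<star>"
  and gauge_one: "gauge t 1 = 1"
  using gauge_hom[of t] by (simp_all add: unital_star_hom_def cstar_of_type_def)

lemma gauge_diff: "gauge t (x - y) = gauge t x - gauge t y"
  using gauge_add[of t "x - y" y] by simp

lemma gauge_power: "gauge t (x ^ n) = gauge t x ^ n"
  by (induction n) (simp_all add: gauge_one gauge_mult)

lemma gauge_Z: "gauge t (Z k) = Z k"
  by (simp add: zpow_def gauge_power gauge_adj gauge_U)

lemma norm_gauge_le: "norm (gauge t x) \<le> norm x"
  by (rule star_hom_contractive[OF gauge_add gauge_mult gauge_scaleC gauge_adj gauge_one])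

lemma bounded_linear_gauge: "bounded_linear (gauge t)"
  by (rule bounded_linear_intro[where K = 1])
    (simp_all add: gauge_add scaleR_scaleC gauge_scaleC norm_gauge_le)

lemma continuous_gauge: "continuous_on A (\<lambda>t. gauge t x)"
proof -
  let ?C = "{x. continuous_on UNIV (\<lambda>t. gauge t x)}"
  have "closed ?C"
    unfolding closed_sequential_limits
  proof (intro allI impI)
    fix X l assume X: "(\<forall>n. X n \<in> ?C) \<and> X \<longlonglongrightarrow> l"
    have "uniform_limit UNIV (\<lambda>n t. gauge t (X n)) (\<lambda>t. gauge t l) sequentially"
    proof (rule uniform_limitI)
      fix e :: real assume "e > 0"
      with X have "eventually (\<lambda>n. dist (X n) l < e) sequentially" by (auto dest: tendstoD)
      thus "eventually (\<lambda>n. \<forall>t\<in>UNIV. dist (gauge t (X n)) (gauge t l) < e) sequentially"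
        by eventually_elim
          (auto simp: dist_norm simp flip: gauge_diff intro: le_less_trans[OF norm_gauge_le])
    qed
    hence "continuous_on UNIV (\<lambda>t. gauge t l)"
      by (rule uniform_limit_theorem[rotated]) (use X in simp_all)
    thus "l \<in> ?C" by simp
  qed
  moreover have "continuous_on UNIV (\<lambda>t. circ t *\<^sub>C S)"
    unfolding circ_def by (intro scaleC.continuous_on continuous_intros)
  moreover have "continuous_on UNIV (\<lambda>t. (gauge t y)\<^sup>\<star>)" "continuous_on UNIV (\<lambda>t. c *\<^sub>C gauge t y)"
    if "continuous_on UNIV (\<lambda>t. gauge t y)" for c y
    using that by (intro continuous_on_adj scaleC.continuous_on continuous_on_const; assumption)+
  ultimately have "unital_cstar_subalgebra ?C" "U \<in> ?C" "S \<in> ?C"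
    by (simp_all add: unital_cstar_subalgebra_def gauge_one gauge_add gauge_mult gauge_scaleC
        gauge_adj gauge_U gauge_S continuous_on_add continuous_on_mult)
  hence "x \<in> ?C" by (rule generated_by_U_S)
  thus ?thesis using continuous_on_subset by blast
qed

text \<open>
  Averages of an orbit of the gauge action against a continuous weight: Fourier components and
  Cesaro means are of this form.
\<close>

definition smear :: "(real \<Rightarrow> complex) \<Rightarrow> 'a \<Rightarrow> 'a" where
  "smear w x = integral {0..1} (\<lambda>t. w t *\<^sub>C gauge t x)"

lemma has_integral_smear:
  assumes "continuous_on {0..1} w"
  shows "((\<lambda>t. w t *\<^sub>C gauge t x) has_integral smear w x) {0..1}"
  unfolding smear_def
  by (intro integrable_integral integrable_continuous_real scaleC.continuous_on continuous_gauge assms)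

lemma smear_add:
  assumes w: "continuous_on {0..1} w"
  shows "smear w (x + y) = smear w x + smear w y"
proof -
  have "((\<lambda>t. w t *\<^sub>C gauge t (x + y)) has_integral smear w x + smear w y) {0..1}"
    unfolding gauge_add scaleC_add_right by (intro has_integral_add has_integral_smear w)
  thus ?thesis using has_integral_unique[OF has_integral_smear[OF w]] by blast
qed

lemma smear_mult:
  assumes w: "continuous_on {0..1} w" and ab: "\<And>t. gauge t a = a" "\<And>t. gauge t b = b"
  shows "smear w (a * x * b) = a * smear w x * b"
proof -
  have "((\<lambda>t. a * (w t *\<^sub>C gauge t x) * b) has_integral a * smear w x * b) {0..1}"
    by (intro has_integral_mult_left has_integral_mult_right has_integral_smear w)
  hence "((\<lambda>t. w t *\<^sub>C gauge t (a * x * b)) has_integral a * smear w x * b) {0..1}"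
    by (simp add: gauge_mult ab mult_scaleC_left mult_scaleC_right)
  thus ?thesis using has_integral_unique[OF has_integral_smear[OF w]] by blast
qed

lemma smear_scaleC:
  assumes "continuous_on {0..1} w"
  shows "smear w (c *\<^sub>C x) = c *\<^sub>C smear w x"
  using smear_mult[OF assms, of "c *\<^sub>C 1" 1 x] by (simp add: gauge_scaleC gauge_one mult_scaleC_left)

lemma smear_diff:
  "continuous_on {0..1} w \<Longrightarrow> smear w (x - y) = smear w x - smear w y"
  using smear_add[of w "x - y" y] by simp

lemma norm_smear_le:
  assumes w: "continuous_on {0..1} w" and I: "((\<lambda>t. norm (w t)) has_integral I) {0..1}"
  shows "norm (smear w x) \<le> I * norm x"
proof -
  have "norm (smear w x) \<le> integral {0..1} (\<lambda>t. norm (w t) * norm x)"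
    unfolding smear_def
  proof (rule Henstock_Kurzweil_Integration.integral_norm_bound_integral)
    show "(\<lambda>t. w t *\<^sub>C gauge t x) integrable_on {0..1}"
      using has_integral_smear[OF w] by blast
    show "(\<lambda>t. norm (w t) * norm x) integrable_on {0..1}"
      using has_integral_mult_left[OF I] by blast
  qed (auto simp: norm_scaleC intro!: mult_left_mono norm_gauge_le)
  also have "\<dots> = I * norm x" using has_integral_mult_left[OF I] by blast
  finally show ?thesis .
qed

lemma smear_eigenvector:
  assumes w: "continuous_on {0..1} w" and x: "\<And>t. gauge t x = v t *\<^sub>C x"
    and I: "((\<lambda>t. w t * v t) has_integral I) {0..1}"
  shows "smear w x = I *\<^sub>C x"
proof -
  have "((\<lambda>t. (w t * v t) *\<^sub>C x) has_integral I *\<^sub>C x) {0..1}"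
    using has_integral_linear[OF I scaleC.bounded_linear_left[of x]] by (simp add: o_def)
  thus ?thesis
    using has_integral_unique[OF has_integral_smear[OF w, of x]] by (simp add: x scaleC_scaleC)
qed

definition fourier :: "int \<Rightarrow> 'a \<Rightarrow> 'a" where
  "fourier n = smear (\<lambda>t. circ t powi (- n))"

lemmas fourier_add = smear_add[OF continuous_on_circ_powi, of "- n" for n, folded fourier_def]
  and fourier_diff = smear_diff[OF continuous_on_circ_powi, of "- n" for n, folded fourier_def]
  and fourier_scaleC = smear_scaleC[OF continuous_on_circ_powi, of "- n" for n, folded fourier_def]
  and fourier_mult = smear_mult[OF continuous_on_circ_powi, of _ _ "- n" for n, folded fourier_def]

lemma norm_fourier_le: "norm (fourier n x) \<le> norm x"
proof -
  have "((\<lambda>t. norm (circ t powi (- n))) has_integral 1) {0..1}"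
    using has_integral_const_real[of "1 :: real" 0 1] by (simp add: norm_power_int)
  from norm_smear_le[OF continuous_on_circ_powi this, of x] show ?thesis
    by (simp add: fourier_def)
qed

definition has_degree :: "'a \<Rightarrow> int \<Rightarrow> bool" where
  "has_degree x n \<longleftrightarrow> (\<forall>t. gauge t x = circ t powi n *\<^sub>C x)"

lemma circ_neq_0 [simp]: "circ t \<noteq> 0"
  using norm_circ[of t] by force

lemma fourier_has_degree:
  assumes "has_degree x n"
  shows "fourier m x = (if m = n then x else 0)"
proof -
  have "fourier m x = (if n - m = 0 then 1 else 0) *\<^sub>C x"
    unfolding fourier_def
  proof (rule smear_eigenvector[OF continuous_on_circ_powi])
    show "gauge t x = circ t powi n *\<^sub>C x" for t using assms by (simp add: has_degree_def)
    have "(\<lambda>t. circ t powi (- m) * circ t powi n) = (\<lambda>t. circ t powi (n - m))"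
      by (simp flip: power_int_add)
    thus "((\<lambda>t. circ t powi (- m) * circ t powi n) has_integral (if n - m = 0 then 1 else 0)) {0..1}"
      using has_integral_circ_powi[of "n - m"] by simp
  qed
  thus ?thesis by (simp add: scaleC.zero_left)
qed

lemma has_degree_mult: "has_degree x m \<Longrightarrow> has_degree y n \<Longrightarrow> has_degree (x * y) (m + n)"
  by (simp add: has_degree_def gauge_mult scaleC_mult_scaleC power_int_add)

lemma has_degree_adj: "has_degree x n \<Longrightarrow> has_degree (x\<^sup>\<star>) (- n)"
  by (simp add: has_degree_def gauge_adj adj_scaleC circ_powi cis_cnj)

lemma has_degree_Z: "has_degree (Z k) 0"
  by (simp add: has_degree_def gauge_Z)

lemma has_degree_S_power: "has_degree (S ^ i) (int i)"
proof (induction i)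
  case 0
  show ?case using has_degree_Z[of 0] by simp
next
  case (Suc i)
  have "has_degree S 1" by (simp add: has_degree_def gauge_S)
  from has_degree_mult[OF this Suc] show ?case by simp
qed

definition monomial :: "int \<Rightarrow> nat \<Rightarrow> nat \<Rightarrow> int \<Rightarrow> 'a" where
  "monomial a i j b = Z a * (S ^ i * (S\<^sup>\<star>) ^ j) * Z b"

lemma has_degree_monomial: "has_degree (monomial a i j b) (int i - int j)"
proof -
  have "has_degree ((S\<^sup>\<star>) ^ j) (- int j)"
    using has_degree_adj[OF has_degree_S_power[of j]] by (simp add: adj_power)
  hence "has_degree (monomial a i j b) (0 + (int i + - int j) + 0)"
    unfolding monomial_def by (intro has_degree_mult has_degree_Z has_degree_S_power)
  thus ?thesis by simp
qed

definition closed_complex_subspace :: "'a set \<Rightarrow> bool" where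
  "closed_complex_subspace V \<longleftrightarrow>
     closed V \<and> 0 \<in> V \<and> (\<forall>x\<in>V. \<forall>y\<in>V. x + y \<in> V) \<and> (\<forall>c. \<forall>x\<in>V. c *\<^sub>C x \<in> V)"

text \<open>
  The monomials span a dense subspace, because left multiplication by a generator or its adjoint
  takes monomials to monomials or to zero.
\<close>

lemma U_monomial: "Z k * monomial a i j b = monomial (k + a) i j b"
  by (simp add: monomial_def mult.assoc Z_add_left)

lemma S_monomial: "S * monomial a i j b = monomial (2 * a) (Suc i) j b"
  by (simp add: monomial_def S_Z flip: mult.assoc)

lemma S_adj_monomial:
  "S\<^sup>\<star> * monomial a i j b = 0 \<or> (\<exists>a' i' j' b'. S\<^sup>\<star> * monomial a i j b = monomial a' i' j' b')"
proof (cases i)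
  case 0
  have even: "S\<^sup>\<star> * Z (2 * m) * (S\<^sup>\<star>) ^ j * Z c = monomial m 0 (Suc j) c" for m c
    by (simp add: S_adj_Z monomial_def mult.assoc)
  show ?thesis
  proof (cases "even a")
    case True
    then obtain m where "a = 2 * m" by blast
    hence "S\<^sup>\<star> * monomial a i j b = monomial m 0 (Suc j) b"
      using even[of m b] 0 by (simp add: monomial_def mult.assoc)
    thus ?thesis by blast
  next
    case False
    then obtain m where a: "a = 2 * m + 1" by (metis oddE)
    have "Z a * (S\<^sup>\<star>) ^ j * Z b = Z (2 * m) * (Z 1 * (S\<^sup>\<star>) ^ j) * Z b"
      by (simp only: a Z_add mult.assoc)
    also have "Z 1 * (S\<^sup>\<star>) ^ j = (S\<^sup>\<star>) ^ j * Z (2 ^ j)"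
      using S_adj_power_Z[of j 1] by simp
    finally have "S\<^sup>\<star> * monomial a i j b = S\<^sup>\<star> * Z (2 * m) * (S\<^sup>\<star>) ^ j * Z (2 ^ j + b)"
      by (simp add: 0 monomial_def mult.assoc Z_add)
    thus ?thesis using even[of m "2 ^ j + b"] by auto
  qed
next
  case (Suc i')
  have "S\<^sup>\<star> * monomial a i j b = (S\<^sup>\<star> * Z a * S) * (S ^ i' * (S\<^sup>\<star>) ^ j) * Z b"
    by (simp add: Suc monomial_def mult.assoc)
  thus ?thesis by (auto simp: S_adj_Z_S monomial_def)
qed

lemma monomials_dense:
  assumes V: "closed_complex_subspace V" and mon: "\<And>a i j b. monomial a i j b \<in> V"
  shows "x \<in> V"
proof -
  define Q where "Q = \<Inter>{V. closed_complex_subspace V \<and> (\<forall>a i j b. monomial a i j b \<in> V)}"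
  have Q: "closed_complex_subspace Q"
    unfolding Q_def by (auto simp: closed_complex_subspace_def)
  have Q_mon: "monomial a i j b \<in> Q" for a i j b by (auto simp: Q_def)
  have Q_least: "Q \<subseteq> W"
    if "closed_complex_subspace W" "\<And>a i j b. monomial a i j b \<in> W" for W
    using that by (auto simp: Q_def)
  have preimage: "closed_complex_subspace {x. g * x \<in> Q}" for g
  proof -
    have "closed {x. g * x \<in> Q}"
      using Q closed_vimage[of Q "\<lambda>x. g * x"]
      by (auto simp: closed_complex_subspace_def vimage_def intro!: continuous_intros)
    thus ?thesis using Q
      by (auto simp: closed_complex_subspace_def distrib_left mult_scaleC_right)
  qed
  have zero: "0 \<in> Q" using Q by (simp add: closed_complex_subspace_def)
  have generators: "Z k * y \<in> Q" "S * y \<in> Q" "S\<^sup>\<star> * y \<in> Q" if "y \<in> Q" for y k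
  proof -
    have "S\<^sup>\<star> * monomial a i j b \<in> Q" for a i j b
      using S_adj_monomial[of a i j b] zero Q_mon by auto
    thus "S\<^sup>\<star> * y \<in> Q"
      using subsetD[OF Q_least[OF preimage] that, of "S\<^sup>\<star>"] by simp
    show "Z k * y \<in> Q" "S * y \<in> Q"
      using subsetD[OF Q_least[OF preimage] that, of "Z k"]
        subsetD[OF Q_least[OF preimage] that, of S]
      by (simp_all add: U_monomial S_monomial Q_mon)
  qed
  let ?M = "{g. \<forall>y\<in>Q. g * y \<in> Q \<and> g\<^sup>\<star> * y \<in> Q}"
  have "unital_cstar_subalgebra ?M"
  proof -
    have "?M = (\<Inter>y\<in>Q. {g. g * y \<in> Q} \<inter> {g. g\<^sup>\<star> * y \<in> Q})" by auto
    moreover have "closed {g. g * y \<in> Q}" "closed {g. g\<^sup>\<star> * y \<in> Q}" for y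
    proof -
      have "closed Q" using Q by (simp add: closed_complex_subspace_def)
      moreover have "continuous_on UNIV (\<lambda>g. g * y)" "continuous_on UNIV (\<lambda>g. g\<^sup>\<star> * y)"
        by (intro continuous_intros continuous_on_adj)+
      ultimately show "closed {g. g * y \<in> Q}" "closed {g. g\<^sup>\<star> * y \<in> Q}"
        using closed_vimage[of Q "\<lambda>g. g * y"] closed_vimage[of Q "\<lambda>g. g\<^sup>\<star> * y"]
        by (simp_all add: vimage_def)
    qed
    ultimately have "closed ?M" by (simp only:) (intro closed_INT ballI closed_Int)
    thus ?thesis using Q
      by (auto simp: unital_cstar_subalgebra_def closed_complex_subspace_def distrib_right
          adj_add adj_mult adj_adj adj_scaleC mult_scaleC_left mult.assoc)
  qed
  moreover have "U \<in> ?M" using generators(1)[of _ 1] generators(1)[of _ "- 1"]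
    by (simp add: zpow_minus_1)
  moreover have "S \<in> ?M" using generators by simp
  ultimately have "x \<in> ?M" by (rule generated_by_U_S)
  moreover have "1 \<in> Q" using Q_mon[of 0 0 0 0] by (simp add: monomial_def)
  ultimately have "x \<in> Q" by force
  thus ?thesis using Q_least[OF V mon] by blast
qed

end

section \<open>The conditional expectation onto the algebra generated by U\<close>

text \<open>
  Contractivity makes the error uniform, so convergence of linear contractions, and membership of the
  limit in a closed set, need only be checked on elements with dense span.
\<close>

lemma closed_convergence_contractive:
  fixes T :: "nat \<Rightarrow> 'a::real_normed_vector \<Rightarrow> 'b::banach"
  assumes T: "\<And>m x y. norm (T m x - T m y) \<le> norm (x - y)" and A: "closed A"
  shows "closed {x. \<exists>t\<in>A. (\<lambda>m. T m x) \<longlonglongrightarrow> t}"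
  unfolding closed_sequential_limits
proof (intro allI impI)
  fix X x assume "(\<forall>n. X n \<in> {x. \<exists>t\<in>A. (\<lambda>m. T m x) \<longlonglongrightarrow> t}) \<and> X \<longlonglongrightarrow> x"
  then obtain t where X: "X \<longlonglongrightarrow> x" and t: "\<And>n. t n \<in> A" "\<And>n. (\<lambda>m. T m (X n)) \<longlonglongrightarrow> t n"
    by (auto simp: Bex_def) metis
  have "Cauchy (\<lambda>m. T m x)"
    unfolding Cauchy_iff
  proof (intro allI impI)
    fix e :: real assume e: "e > 0"
    obtain n where n: "norm (X n - x) < e / 3"
      using LIMSEQ_D[OF X, of "e / 3"] e by auto
    obtain M where M: "\<And>m m'. m \<ge> M \<Longrightarrow> m' \<ge> M \<Longrightarrow> norm (T m (X n) - T m' (X n)) < e / 3"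
      using LIMSEQ_imp_Cauchy[OF t(2)[of n]] e unfolding Cauchy_iff by (metis divide_pos_pos zero_less_numeral)
    have "norm (T m x - T m' x) < e" if "m \<ge> M" "m' \<ge> M" for m m'
    proof -
      have "norm (T m x - T m' x) \<le> norm (T m x - T m (X n)) + norm (T m (X n) - T m' (X n)) +
          norm (T m' (X n) - T m' x)"
        by (rule order_trans[OF _ add_right_mono[OF norm_triangle_ineq]], rule norm_diff_triangle_le)
          (auto simp: algebra_simps)
      also have "\<dots> < e / 3 + e / 3 + e / 3"
        using T[of m x "X n"] T[of m' "X n" x] M[OF that] n
        by (simp add: norm_minus_commute)
      finally show ?thesis by simp
    qed
    thus "\<exists>M. \<forall>m\<ge>M. \<forall>m'\<ge>M. norm (T m x - T m' x) < e" by blast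
  qed
  then obtain s where s: "(\<lambda>m. T m x) \<longlonglongrightarrow> s"
    using Cauchy_convergent convergent_def by blast
  have "norm (t n - s) \<le> norm (X n - x)" for n
    by (rule LIMSEQ_le_const2[OF tendsto_norm[OF tendsto_diff[OF t(2) s]]]) (use T in blast)
  hence "(\<lambda>n. t n - s) \<longlonglongrightarrow> 0"
    using X by (intro Lim_null_comparison[OF _ tendsto_norm_zero[OF LIM_zero[OF X]]]) auto
  hence "t \<longlonglongrightarrow> s" by (rule LIM_zero_cancel)
  hence "s \<in> A" using A t(1) closed_sequentially by blast
  thus "x \<in> {x. \<exists>t\<in>A. (\<lambda>m. T m x) \<longlonglongrightarrow> t}" using s by blast
qed

context two_adic_ring_algebra
begin

text \<open>
  The C*-algebra generated by \<open>U\<close>: the values at \<open>U\<close> of the continuous functions on the circle.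
\<close>

definition CU :: "'a set" where
  "CU = closure {y. \<exists>d f. laurent U d f y}"

lemma closed_CU: "closed CU" by (simp add: CU_def)

lemma laurent_in_CU: "laurent U d f y \<Longrightarrow> y \<in> CU"
  unfolding CU_def by (rule subsetD[OF closure_subset]) blast

lemma calc_iff_CU: "x \<in> CU \<longleftrightarrow> (\<exists>f. calc U f x)"
proof
  assume "x \<in> CU"
  thus "\<exists>f. calc U f x" unfolding CU_def by (rule calc_of_closure[OF full_unitary_U])
next
  assume "\<exists>f. calc U f x"
  then obtain g y where y: "\<forall>n. \<exists>d. laurent U d (g n) (y n)" "y \<longlonglongrightarrow> x"
    unfolding calc_def by blast
  hence "\<forall>n. y n \<in> {y. \<exists>d f. laurent U d f y}" by blast
  with y(2) show "x \<in> CU" unfolding CU_def closure_sequential by blast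
qed

text \<open>
  On the monomials of degree zero, averaging is eventually constant with values in the span of the
  powers of \<open>U\<close>; by density the averages converge on every element of degree zero.
\<close>

lemma averages_converge: "\<exists>t\<in>CU. (\<lambda>m. avg m (fourier 0 x)) \<longlonglongrightarrow> t"
proof -
  let ?V = "{x. \<exists>t\<in>CU. (\<lambda>m. avg m (fourier 0 x)) \<longlonglongrightarrow> t}"
  have V_closed: "closed ?V"
  proof (rule closed_convergence_contractive[OF _ closed_CU])
    fix m x y
    show "norm (avg m (fourier 0 x) - avg m (fourier 0 y)) \<le> norm (x - y)"
      using order_trans[OF norm_avg_le norm_fourier_le]
      by (simp flip: avg_diff fourier_diff)
  qed
  have V_add: "x + y \<in> ?V" if xy: "x \<in> ?V" "y \<in> ?V" for x y
  proof -
    obtain s t where "s \<in> CU" "(\<lambda>m. avg m (fourier 0 x)) \<longlonglongrightarrow> s"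
      "t \<in> CU" "(\<lambda>m. avg m (fourier 0 y)) \<longlonglongrightarrow> t"
      using xy by blast
    moreover from this have "s + t \<in> CU" using calc_add unfolding calc_iff_CU by blast
    ultimately show ?thesis
      by (auto simp: fourier_add avg_add intro!: bexI[of _ "s + t"] tendsto_add)
  qed
  have V_scale: "c *\<^sub>C x \<in> ?V" if x: "x \<in> ?V" for c x
  proof -
    obtain s where "s \<in> CU" "(\<lambda>m. avg m (fourier 0 x)) \<longlonglongrightarrow> s"
      using x by blast
    moreover from this have "c *\<^sub>C s \<in> CU"
      using calc_scale[OF unitary_U] unfolding calc_iff_CU by blast
    ultimately show ?thesis
      by (auto simp: fourier_scaleC avg_scaleC intro!: bexI[of _ "c *\<^sub>C s"] scaleC.tendsto)
  qed
  have zero: "0 \<in> CU" by (rule laurent_in_CU[OF laurent_zero])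
  have V_mon: "monomial a i j b \<in> ?V" for a i j b
  proof (cases "i = j")
    case False
    hence "fourier 0 (monomial a i j b) = 0"
      by (simp add: fourier_has_degree[OF has_degree_monomial])
    thus ?thesis using zero by (auto simp: avg_of_commuting)
  next
    case True
    define t where "t = complex_of_real (1 / 2 ^ i) *\<^sub>C Z (a + b)"
    have "avg m (fourier 0 (monomial a i j b)) = t" if "m \<ge> i" for m
      using True avg_projection[OF that]
      by (simp add: fourier_has_degree[OF has_degree_monomial])
        (simp add: monomial_def avg_bimodule t_def Z_add scaleR_scaleC mult_scaleC_left mult_scaleC_right)
    hence "(\<lambda>m. avg m (fourier 0 (monomial a i j b))) \<longlonglongrightarrow> t"
      by (intro tendsto_eventually) (auto simp: eventually_sequentially)
    moreover have "t \<in> CU"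
      unfolding t_def by (rule laurent_in_CU[OF laurent_monomial[where d = "nat \<bar>a + b\<bar>"]]) simp
    ultimately show ?thesis by blast
  qed
  have V_0: "0 \<in> ?V" using zero fourier_diff[of 0 0 0] by (auto simp: avg_of_commuting)
  have "closed_complex_subspace ?V"
    unfolding closed_complex_subspace_def
    by (intro conjI ballI allI; (rule V_closed V_0 V_add V_scale; assumption?)+)
  hence "x \<in> ?V" by (rule monomials_dense) (rule V_mon)
  thus ?thesis by simp
qed

text \<open>
  The canonical conditional expectation onto the C*-algebra generated by \<open>U\<close>. Averaging alone
  would not converge in norm; projecting to degree zero first makes it converge.
\<close>

definition expect :: "'a \<Rightarrow> 'a" where
  "expect x = lim (\<lambda>m. avg m (fourier 0 x))"

lemma expect_LIMSEQ: "(\<lambda>m. avg m (fourier 0 x)) \<longlonglongrightarrow> expect x"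
  and expect_in_CU: "expect x \<in> CU"
  using averages_converge[of x] by (auto simp: expect_def limI)

lemma expect_add: "expect (x + y) = expect x + expect y"
  using tendsto_add[OF expect_LIMSEQ[of x] expect_LIMSEQ[of y]] LIMSEQ_unique[OF expect_LIMSEQ]
  by (simp add: fourier_add avg_add)

lemma expect_scaleC: "expect (c *\<^sub>C x) = c *\<^sub>C expect x"
  using scaleC.tendsto[OF tendsto_const[of c] expect_LIMSEQ[of x]] LIMSEQ_unique[OF expect_LIMSEQ]
  by (simp add: fourier_scaleC avg_scaleC)

lemma norm_expect_le: "norm (expect x) \<le> norm x"
  by (rule Lim_bounded[OF tendsto_norm[OF expect_LIMSEQ[of x]], of 0])
    (use order_trans[OF norm_avg_le norm_fourier_le] in blast)

lemma bounded_linear_expect: "bounded_linear expect"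
  by (rule bounded_linear_intro[where K = 1])
    (simp_all add: expect_add scaleR_scaleC expect_scaleC norm_expect_le)

lemma expect_bimodule: "expect (Z a * x * Z b) = Z a * expect x * Z b"
proof (rule LIMSEQ_unique[OF expect_LIMSEQ])
  have "avg m (fourier 0 (Z a * x * Z b)) = Z a * avg m (fourier 0 x) * Z b" for m
    by (simp add: fourier_mult gauge_Z avg_bimodule)
  thus "(\<lambda>m. avg m (fourier 0 (Z a * x * Z b))) \<longlonglongrightarrow> Z a * expect x * Z b"
    by (simp add: tendsto_mult expect_LIMSEQ)
qed

lemma expect_of_commuting:
  assumes "x * U = U * x" "has_degree x 0"
  shows "expect x = x"
  using LIMSEQ_unique[OF expect_LIMSEQ[of x]]
  by (simp add: fourier_has_degree[OF assms(2)] avg_of_commuting[OF assms(1)])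

lemma expect_eq_0_of_degree:
  assumes "has_degree x n" "n \<noteq> 0"
  shows "expect x = 0"
proof (rule LIMSEQ_unique[OF expect_LIMSEQ])
  show "(\<lambda>m. avg m (fourier 0 x)) \<longlonglongrightarrow> 0"
    using assms(2) by (simp add: fourier_has_degree[OF assms(1)] avg_of_commuting)
qed

end

section \<open>Commutation with U forces degree zero\<close>

lemma circle_subset_closure_diff_finite:
  assumes "finite F"
  shows "sphere 0 1 \<subseteq> closure (sphere 0 1 - F :: complex set)"
proof
  fix z :: complex assume z: "z \<in> sphere 0 1"
  have "sphere 0 1 \<noteq> {x}" for x :: complex
  proof
    assume "sphere 0 1 = {x}"
    hence "1 \<in> {x}" "- 1 \<in> {x}" by (metis dist_0_norm mem_sphere norm_minus_cancel norm_one)+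
    thus False by simp
  qed
  hence "z islimpt sphere 0 1"
    using z by (intro connected_imp_perfect connected_sphere) auto
  hence "z islimpt (F \<union> (sphere 0 1 - F))"
    by (rule islimpt_subset) auto
  hence "z islimpt (sphere 0 1 - F)"
    by (rule islimpt_Un_finite[OF assms, THEN iffD1])
  thus "z \<in> closure (sphere 0 1 - F)" by (simp add: closure_def)
qed

context two_adic_ring_algebra
begin

text \<open>
  A relation \<open>U ^ p * t = t * U ^ q\<close> in the commutative algebra generated by \<open>U\<close> says that the
  function of \<open>t\<close> vanishes away from the finitely many \<open>z\<close> with \<open>z ^ p = z ^ q\<close>, hence everywhere.
\<close>

lemma CU_eq_0_of_shift:
  assumes t: "t \<in> CU" and shift: "Z (int p) * t = t * Z (int q)" and pq: "p \<noteq> q"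
  shows "t = 0"
proof -
  obtain f where f: "calc U f t" using t calc_iff_CU by blast
  have Zc: "calc U (\<lambda>z. z powi k) (Z k)" for k
    using calc_laurent[OF laurent_monomial[of k "nat \<bar>k\<bar>" U 1]] by simp
  have "calc U (\<lambda>z. z powi int p * f z - f z * z powi int q) 0"
    using calc_diff[OF unitary_U calc_mult[OF unitary_U Zc[of "int p"] f]
        calc_mult[OF unitary_U f Zc[of "int q"]]] by (simp add: shift)
  hence zero: "z ^ p * f z - f z * z ^ q = 0" if "z \<in> sphere 0 1" for z
    using norm_calc_ge[OF full_unitary_U _ that] by force
  define F where "F = {z :: complex. z ^ (max p q - min p q) = 1}"
  have "finite F"
    unfolding F_def using pq by (intro finite_roots_unity) auto
  have off: "f z = 0" if z: "z \<in> sphere 0 1 - F" for z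
  proof (rule ccontr)
    assume "f z \<noteq> 0"
    hence eq: "z ^ p = z ^ q" using zero[of z] z by (simp add: mult.commute)
    hence "z ^ max p q = z ^ min p q" by (simp add: max_def min_def)
    moreover have "z ^ max p q = z ^ min p q * z ^ (max p q - min p q)"
      by (simp flip: power_add)
    moreover have "z \<noteq> 0" using z by auto
    ultimately have "z \<in> F" by (simp add: F_def)
    thus False using z by simp
  qed
  have sub: "closure (sphere 0 1 - F) = sphere 0 1"
    using circle_subset_closure_diff_finite[OF \<open>finite F\<close>]
    by (metis Diff_subset closed_sphere closure_minimal subset_antisym)
  have "f z = 0" if "z \<in> sphere 0 1" for z
    using continuous_constant_on_closure[of "sphere 0 1 - F" f 0 z] off that
      calc_continuous[OF f] unfolding sub by blast
  thus ?thesis using norm_calc_le[OF unitary_U f, of 0] by simp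
qed

text \<open>
  For \<open>i \<noteq> j\<close>, commutation of \<open>y\<close> with \<open>U\<close> gives \<open>U ^ 2 ^ i * x = x * U ^ 2 ^ j\<close> for
  \<open>x = y * S ^ i * S\<^sup>\<star> ^ j\<close>, so the expectation of \<open>x\<close> vanishes; for \<open>i = j\<close> it vanishes since \<open>x\<close>
  has nonzero degree. By density the expectation kills \<open>y * x\<close> for every \<open>x\<close>, in particular
  \<open>y * y\<^sup>\<star>\<close>, which it also fixes.
\<close>

lemma commuting_of_nonzero_degree:
  assumes y: "y * U = U * y" and deg: "has_degree y n" and n: "n \<noteq> 0"
  shows "y = 0"
proof -
  have yZ: "y * Z k = Z k * y" for k by (rule Z_commute[OF y])
  let ?V = "{x. expect (y * x) = 0}"
  have "closed ?V"
    by (intro closed_Collect_eq bounded_linear.continuous_on[OF bounded_linear_expect]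
        continuous_intros)
  moreover have "monomial a i j b \<in> ?V" for a i j b
  proof -
    define t where "t = expect (y * (S ^ i * (S\<^sup>\<star>) ^ j))"
    have "t = 0"
    proof (cases "i = j")
      case True
      have "has_degree (y * (S ^ i * (S\<^sup>\<star>) ^ j)) (n + (int i - int j))"
        using has_degree_monomial[of 0 i j 0] by (intro has_degree_mult deg) (simp add: monomial_def)
      thus ?thesis using n True by (auto simp: t_def intro: expect_eq_0_of_degree)
    next
      case False
      have "Z (int (2 ^ i)) * (y * (S ^ i * (S\<^sup>\<star>) ^ j)) = y * (Z (2 ^ i * 1) * S ^ i) * (S\<^sup>\<star>) ^ j"
        using yZ[of "2 ^ i"] by (simp flip: mult.assoc)
      also have "\<dots> = y * (S ^ i * (Z 1 * (S\<^sup>\<star>) ^ j))"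
        by (simp only: S_power_Z[symmetric] mult.assoc)
      also have "\<dots> = (y * (S ^ i * (S\<^sup>\<star>) ^ j)) * Z (int (2 ^ j))"
        by (simp only: S_adj_power_Z[symmetric] mult.assoc) simp
      finally have "Z (int (2 ^ i)) * t = t * Z (int (2 ^ j))"
        using expect_bimodule[of "int (2 ^ i)" "y * (S ^ i * (S\<^sup>\<star>) ^ j)" 0]
          expect_bimodule[of 0 "y * (S ^ i * (S\<^sup>\<star>) ^ j)" "int (2 ^ j)"]
        by (simp add: t_def)
      thus ?thesis
        using False by (intro CU_eq_0_of_shift[of t "2 ^ i" "2 ^ j"]) (auto simp: t_def expect_in_CU)
    qed
    moreover have "y * monomial a i j b = Z a * (y * (S ^ i * (S\<^sup>\<star>) ^ j)) * Z b"
      using yZ[of a] by (simp add: monomial_def flip: mult.assoc)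
    ultimately show ?thesis by (simp add: expect_bimodule t_def)
  qed
  ultimately have "closed_complex_subspace ?V"
    by (simp add: closed_complex_subspace_def distrib_left mult_scaleC_right expect_add
        expect_scaleC linear_0[OF bounded_linear.linear[OF bounded_linear_expect]] scaleC.zero_right)
  hence "y\<^sup>\<star> \<in> ?V"
    by (rule monomials_dense) fact
  hence "expect (y * y\<^sup>\<star>) = 0" by simp
  moreover have "expect (y * y\<^sup>\<star>) = y * y\<^sup>\<star>"
  proof (rule expect_of_commuting)
    have "y\<^sup>\<star> * U = U * y\<^sup>\<star>"
      using arg_cong[OF yZ[of "- 1"], of adj] by (simp add: zpow_minus_1 adj_mult adj_adj)
    thus "y * y\<^sup>\<star> * U = U * (y * y\<^sup>\<star>)"
      using y by (metis mult.assoc)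
    show "has_degree (y * y\<^sup>\<star>) 0"
      using has_degree_mult[OF deg has_degree_adj[OF deg]] by simp
  qed
  ultimately show ?thesis by (auto intro: eq_zero_of_mult_adj)
qed

end

section \<open>Cesaro means of the Fourier components\<close>

lemma card_pairs_difference:
  "(\<Sum>a<N. \<Sum>b<N. if int b - int a = n then 1 else 0 :: real) = real (N - nat \<bar>n\<bar>)"
proof -
  have nonneg: "(\<Sum>a<N. \<Sum>b<N. if int b - int a = int k then 1 else 0 :: real) = real (N - k)" for k
  proof -
    have "(\<Sum>b<N. if int b - int a = int k then 1 else 0 :: real) = (if a < N - k then 1 else 0)" for a
    proof -
      have "(int b - int a = int k) = (b = a + k)" for b by auto
      thus ?thesis by auto
    qed
    hence "(\<Sum>a<N. \<Sum>b<N. if int b - int a = int k then 1 else 0 :: real) =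
        (\<Sum>a<N. if a < N - k then 1 else 0)" by simp
    also have "\<dots> = (\<Sum>a<N - k. 1)"
      by (intro sum.mono_neutral_cong_right) auto
    finally show ?thesis by simp
  qed
  show ?thesis
  proof (cases "0 \<le> n")
    case True
    thus ?thesis using nonneg[of "nat n"] by simp
  next
    case False
    have "(\<Sum>a<N. \<Sum>b<N. if int b - int a = n then 1 else 0 :: real) =
        (\<Sum>b<N. \<Sum>a<N. if int a - int b = - n then 1 else 0)"
      by (subst sum.swap) (intro sum.cong refl; auto)
    thus ?thesis using nonneg[of "nat (- n)"] False by simp
  qed
qed

context two_adic_ring_algebra
begin

lemma has_degree_fourier: "has_degree (fourier n x) n"
  unfolding has_degree_def
proof
  fix t
  let ?V = "{x. gauge t (fourier n x) = circ t powi n *\<^sub>C fourier n x}"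
  have fl: "bounded_linear (fourier n)"
    by (rule bounded_linear_intro[where K = 1])
      (simp_all add: fourier_add scaleR_scaleC fourier_scaleC norm_fourier_le)
  have "closed ?V"
    by (intro closed_Collect_eq bounded_linear.continuous_on[OF bounded_linear_gauge]
        bounded_linear.continuous_on[OF fl] scaleC.continuous_on continuous_intros)
  hence "closed_complex_subspace ?V"
    by (simp add: closed_complex_subspace_def fourier_add gauge_add fourier_scaleC gauge_scaleC
        scaleC_add_right scaleC_scaleC mult.commute linear_0[OF bounded_linear.linear[OF fl]]
        linear_0[OF bounded_linear.linear[OF bounded_linear_gauge]] scaleC.zero_right)
  moreover have "monomial a i j b \<in> ?V" for a i j b
    using has_degree_monomial[of a i j b]
    by (auto simp: fourier_has_degree[OF has_degree_monomial] has_degree_def scaleC.zero_right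
        linear_0[OF bounded_linear.linear[OF bounded_linear_gauge]])
  ultimately have "x \<in> ?V" by (rule monomials_dense)
  thus "gauge t (fourier n x) = circ t powi n *\<^sub>C fourier n x" by simp
qed

definition cesaro :: "nat \<Rightarrow> 'a \<Rightarrow> 'a" where
  "cesaro N x = (1 / real N) *\<^sub>R (\<Sum>a<N. \<Sum>b<N. fourier (int b - int a) x)"

lemma cesaro_diff: "cesaro N (x - y) = cesaro N x - cesaro N y"
  by (simp add: cesaro_def fourier_diff sum_subtractf algebra_simps)

lemma cesaro_add: "cesaro N (x + y) = cesaro N x + cesaro N y"
  by (simp add: cesaro_def fourier_add sum.distrib algebra_simps)

lemma cesaro_scaleC: "cesaro N (c *\<^sub>C x) = c *\<^sub>C cesaro N x"
  by (simp add: cesaro_def fourier_scaleC scaleC.sum_right scaleR_scaleC scaleC_scaleC mult.commute)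

text \<open>
  The Cesaro means are averages of the orbit against the Fejer kernel \<open>\<bar>\<Sum>a<N. z ^ a\<bar>\<^sup>2 / N\<close>,
  a nonnegative function of integral one.
\<close>

lemma norm_cesaro_le:
  assumes N: "N > 0"
  shows "norm (cesaro N x) \<le> norm x"
proof -
  define w where "w t = (\<Sum>a<N. \<Sum>b<N. circ t powi (int a - int b))" for t
  have cw: "continuous_on {0..1} w"
    unfolding w_def by (intro continuous_intros continuous_on_circ_powi)
  have w_norm: "complex_of_real (norm (w t)) = w t" for t
  proof -
    have "w t = (\<Sum>a<N. circ t powi int a) * cnj (\<Sum>b<N. circ t powi int b)"
      unfolding w_def sum_product cnj_sum
      by (intro sum.cong refl) (simp only: circ_powi cis_cnj cis_mult; simp add: algebra_simps)
    hence "w t = complex_of_real ((norm (\<Sum>a<N. circ t powi int a))\<^sup>2)"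
      by (simp only: complex_norm_square)
    thus ?thesis by (metis abs_of_nonneg norm_of_real zero_le_power2)
  qed
  have "(w has_integral (\<Sum>a<N. \<Sum>b<N. if int a - int b = 0 then 1 else 0)) {0..1}"
    unfolding w_def by (intro has_integral_sum has_integral_circ_powi finite_lessThan)
  also have "(\<Sum>a<N. \<Sum>b<N. if int a - int b = 0 then 1 else 0) = complex_of_nat N"
    by simp
  finally have "(w has_integral complex_of_nat N) {0..1}" .
  from has_integral_linear[OF this bounded_linear_Re]
  have "((\<lambda>t. Re (w t)) has_integral Re (complex_of_nat N)) {0..1}"
    by (simp add: o_def)
  moreover have "Re (w t) = norm (w t)" for t
    using w_norm[of t] by (metis Re_complex_of_real)
  ultimately have I: "((\<lambda>t. norm (w t)) has_integral real N) {0..1}" by simp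
  have "smear w x = (\<Sum>a<N. \<Sum>b<N. fourier (int b - int a) x)"
  proof (rule has_integral_unique[OF has_integral_smear[OF cw]])
    have "((\<lambda>t. \<Sum>a<N. \<Sum>b<N. circ t powi (- (int b - int a)) *\<^sub>C gauge t x) has_integral
        (\<Sum>a<N. \<Sum>b<N. fourier (int b - int a) x)) {0..1}"
      unfolding fourier_def
      by (intro has_integral_sum has_integral_smear continuous_on_circ_powi finite_lessThan)
    thus "((\<lambda>t. w t *\<^sub>C gauge t x) has_integral (\<Sum>a<N. \<Sum>b<N. fourier (int b - int a) x)) {0..1}"
      by (simp add: w_def scaleC.sum_left)
  qed
  hence "real N * norm (cesaro N x) = norm (smear w x)"
    using N by (simp add: cesaro_def)
  also have "\<dots> \<le> real N * norm x" by (rule norm_smear_le[OF cw I])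
  finally show ?thesis using N by simp
qed

lemma cesaro_has_degree:
  assumes "has_degree x n"
  shows "cesaro N x = (real (N - nat \<bar>n\<bar>) / real N) *\<^sub>R x"
proof -
  have "(\<Sum>a<N. \<Sum>b<N. fourier (int b - int a) x) =
      (\<Sum>a<N. \<Sum>b<N. (if int b - int a = n then 1 else 0 :: real) *\<^sub>R x)"
    by (intro sum.cong refl) (simp add: fourier_has_degree[OF assms])
  thus ?thesis
    unfolding cesaro_def by (simp add: card_pairs_difference flip: scaleR_sum_left)
qed

lemma cesaro_LIMSEQ: "(\<lambda>N. cesaro (Suc N) x) \<longlonglongrightarrow> x"
proof -
  have half: "((\<lambda>N. (1 / 2) *\<^sub>R d N) \<longlonglongrightarrow> 0) = (d \<longlonglongrightarrow> 0)" for d :: "nat \<Rightarrow> 'a"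
    using tendsto_scaleR[OF tendsto_const[of 2], of "\<lambda>N. (1 / 2) *\<^sub>R d N" 0]
      tendsto_scaleR[OF tendsto_const[of "1 / 2"], of d 0] by auto
  (* The factor 1 / 2 makes the maps contractive. *)
  let ?V = "{x. \<exists>t\<in>{0}. (\<lambda>N. (1 / 2) *\<^sub>R (cesaro (Suc N) x - x)) \<longlonglongrightarrow> t}"
  have "closed ?V"
  proof (rule closed_convergence_contractive)
    fix N x y
    have "(1 / 2) *\<^sub>R (cesaro (Suc N) x - x) - (1 / 2) *\<^sub>R (cesaro (Suc N) y - y) =
        (1 / 2) *\<^sub>R (cesaro (Suc N) (x - y) - (x - y))"
      by (simp add: cesaro_diff algebra_simps)
    also have "norm \<dots> \<le> (1 / 2) * (norm (x - y) + norm (x - y))"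
      using norm_triangle_ineq4[of "cesaro (Suc N) (x - y)" "x - y"] norm_cesaro_le[of "Suc N" "x - y"]
      by simp
    finally show "norm ((1 / 2) *\<^sub>R (cesaro (Suc N) x - x) - (1 / 2) *\<^sub>R (cesaro (Suc N) y - y))
        \<le> norm (x - y)" by simp
  qed simp
  also have "?V = {x. (\<lambda>N. cesaro (Suc N) x) \<longlonglongrightarrow> x}"
    using half by (auto simp: LIM_zero_iff simp del: scaleR_left.diff scaleR_right.diff)
  finally have "closed {x. (\<lambda>N. cesaro (Suc N) x) \<longlonglongrightarrow> x}" .
  moreover have "monomial a i j b \<in> {x. (\<lambda>N. cesaro (Suc N) x) \<longlonglongrightarrow> x}" for a i j b
  proof -
    let ?k = "nat \<bar>int i - int j\<bar>"
    have "(\<lambda>N. real (Suc N - ?k) / real (Suc N)) \<longlonglongrightarrow> 1"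
    proof (rule Lim_transform_eventually)
      show "(\<lambda>N. 1 - real ?k * inverse (real (Suc N))) \<longlonglongrightarrow> 1"
        using tendsto_diff[OF tendsto_const[of 1] tendsto_mult[OF tendsto_const[of "real ?k"]
            LIMSEQ_inverse_real_of_nat]] by simp
      show "\<forall>\<^sub>F N in sequentially. 1 - real ?k * inverse (real (Suc N)) =
          real (Suc N - ?k) / real (Suc N)"
        using eventually_ge_at_top[of ?k] by eventually_elim (simp add: of_nat_diff field_simps)
    qed
    from tendsto_scaleR[OF this tendsto_const[of "monomial a i j b"]] show ?thesis
      by (simp add: cesaro_has_degree[OF has_degree_monomial])
  qed
  moreover have "cesaro N 0 = 0" for N
    using cesaro_diff[of N 0 0] by simp
  moreover have "(\<lambda>N. c *\<^sub>C cesaro (Suc N) y) \<longlonglongrightarrow> c *\<^sub>C y"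
    if "(\<lambda>N. cesaro (Suc N) y) \<longlonglongrightarrow> y" for c y
    by (intro scaleC.tendsto tendsto_const that)
  ultimately have "closed_complex_subspace {x. (\<lambda>N. cesaro (Suc N) x) \<longlonglongrightarrow> x}"
    "\<And>a i j b. monomial a i j b \<in> {x. (\<lambda>N. cesaro (Suc N) x) \<longlonglongrightarrow> x}"
    by (simp_all add: closed_complex_subspace_def cesaro_add cesaro_scaleC tendsto_add)
  hence "x \<in> {x. (\<lambda>N. cesaro (Suc N) x) \<longlonglongrightarrow> x}" by (rule monomials_dense)
  thus ?thesis by simp
qed

text \<open>
  The Fourier components of an element commuting with \<open>U\<close> commute with \<open>U\<close> as well. Only the one
  of degree zero can survive, and it is then equal to all Cesaro means.
\<close>

lemma has_degree_0_of_commuting: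
  assumes x: "x * U = U * x"
  shows "has_degree x 0"
proof -
  have "fourier n x = 0" if "n \<noteq> 0" for n
  proof (rule commuting_of_nonzero_degree[OF _ has_degree_fourier that])
    show "fourier n x * U = U * fourier n x"
      using fourier_mult[of 1 U n x] fourier_mult[of U 1 n x] x
      by (simp add: gauge_U gauge_one)
  qed
  hence "fourier (int b - int a) x = (if a = b then fourier 0 x else 0)" for a b by simp
  hence "cesaro (Suc N) x = fourier 0 x" for N
    by (simp add: cesaro_def sum_constant_scaleR del: sum_constant sum.lessThan_Suc)
  hence "fourier 0 x = x"
    using LIMSEQ_unique[OF cesaro_LIMSEQ[of x], of "fourier 0 x"] by simp
  thus ?thesis using has_degree_fourier[of 0 x] by simp
qed

text \<open>An element of degree zero which commutes with \<open>U\<close> is its own conditional expectation.\<close>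

lemma commutant_U: "x * U = U * x \<Longrightarrow> \<exists>f. calc U f x"
  using expect_of_commuting[OF _ has_degree_0_of_commuting] expect_in_CU[of x] calc_iff_CU by metis

end

section \<open>The intertwining unitary\<close>

text \<open>
  The element carrying \<open>S\<close> to \<open>s\<close> and \<open>U * S\<close> to \<open>U * s\<close>. It is isometric since the ranges of \<open>s\<close>
  and \<open>U * s\<close> are orthogonal and those of \<open>S\<close> and \<open>U * S\<close> fill the space.
\<close>

lemma intertwiner_isometry:
  assumes "two_adic_pair U S" "two_adic_pair U s"
  defines "V \<equiv> s * S\<^sup>\<star> + U * s * S\<^sup>\<star> * U\<^sup>\<star>"
  shows "V\<^sup>\<star> * V = 1"
proof -
  interpret S: two_adic_pair U S by fact
  interpret s: two_adic_pair U s by fact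
  have zero: "s\<^sup>\<star> * (U * (s * x)) = 0" for x
    using s.S_adj_U_S by (simp flip: mult.assoc)
  have zero': "s\<^sup>\<star> * (U\<^sup>\<star> * (s * x)) = 0" for x
    using s.S_adj_Z_S[of "- 1"] by (simp add: zpow_minus_1 flip: mult.assoc)
  have one: "s\<^sup>\<star> * (s * x) = x" "U\<^sup>\<star> * (U * x) = x" for x
    using s.isometry_S s.U_adj_U by (simp_all flip: mult.assoc)
  have "V\<^sup>\<star> * V = S * S\<^sup>\<star> + U * S * S\<^sup>\<star> * U\<^sup>\<star>"
    by (simp add: V_def adj_add adj_mult adj_adj algebra_simps zero zero' one)
  thus ?thesis by (simp add: S.range_sum)
qed

theorem theorem6p13:
  fixes U S\<^sub>2 s :: "'a::unital_cstar_algebra"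
  assumes "is_Q2 U S\<^sub>2"
    and "s \<in> S2_set U"
  shows "\<exists>f :: complex \<Rightarrow> complex.
           continuous_on (sphere 0 1) f \<and> f ` sphere 0 1 \<subseteq> sphere 0 1 \<and>
           s = cfc f U * S\<^sub>2"
proof -
  interpret two_adic_ring_algebra U S\<^sub>2 by unfold_locales fact
  interpret s: two_adic_pair U s
    using assms(2) unitary_U by unfold_locales (auto simp: S2_set_def)
  define V where "V = s * S\<^sub>2\<^sup>\<star> + U * s * S\<^sub>2\<^sup>\<star> * U\<^sup>\<star>"
  have "V * U = U * V"
  proof -
    have "s * (S\<^sub>2\<^sup>\<star> * U) = s * U * S\<^sub>2\<^sup>\<star> * U\<^sup>\<star>"
    proof -
      have "U * S\<^sub>2\<^sup>\<star> * U\<^sup>\<star> = S\<^sub>2\<^sup>\<star> * Z (2 * 1) * U\<^sup>\<star>"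
        by (simp only: S_adj_Z zpow_1)
      also have "\<dots> = S\<^sub>2\<^sup>\<star> * U"
        by (simp add: mult.assoc flip: Z_add zpow_minus_1)
      finally show ?thesis by (simp add: mult.assoc)
    qed
    thus ?thesis
      using s.S_U U_adj_U
      by (simp add: V_def distrib_left distrib_right mult.assoc power2_eq_square)
  qed
  then obtain f where f: "calc U f V" using commutant_U by blast
  have "V\<^sup>\<star> * V = 1"
    unfolding V_def by (intro intertwiner_isometry) unfold_locales
  hence "calc U (\<lambda>z. cnj (f z) * f z - 1) 0"
    using calc_diff[OF unitary_U calc_mult[OF unitary_U calc_adj[OF unitary_U f] f] calc_const[of U 1]]
    by simp
  hence f_circle: "norm (f z) = 1" if "z \<in> sphere 0 1" for z
  proof -
    have "cnj (f z) * f z = 1"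
      using norm_calc_ge[OF full_unitary_U \<open>calc U (\<lambda>z. cnj (f z) * f z - 1) 0\<close> that] by simp
    hence "complex_of_real ((norm (f z))\<^sup>2) = 1"
      by (simp only: complex_norm_square mult.commute)
    hence "(norm (f z))\<^sup>2 = 1" by (simp only: of_real_eq_1_iff)
    thus ?thesis using norm_ge_zero[of "f z"] unfolding power2_eq_1_iff by linarith
  qed
  have "V * S\<^sub>2 = s * (S\<^sub>2\<^sup>\<star> * S\<^sub>2) + U * s * (S\<^sub>2\<^sup>\<star> * Z (- 1) * S\<^sub>2)"
    by (simp add: V_def distrib_right mult.assoc zpow_minus_1)
  also have "\<dots> = s" by (simp add: S_adj_Z_S isometry_S)
  finally have "s = cfc f U * S\<^sub>2"
    by (simp add: cfc_eq_calc[OF full_unitary_U f])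
  thus ?thesis using calc_continuous[OF f] f_circle by (intro exI[of _ f]) auto
qed

end
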